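(* Let $\theta\in[0,\frac{\pi}{2})$ with $\tan\theta=\frac{M}{N}$ rational, where $M\ge 0$ and $N\ge 1$ are integers, and let $\sigma=\sigma_1\sigma_2\ldots\in\{0,1\}^{\mathbb N}$. For every $a\in J_\theta=[-\frac MN,1]$ there exists $\kappa\in\{1,2,\ldots,N+M\}$ such that $a\in\left[\frac{-M-1+\kappa}{N},\frac{-M+\kappa}{N}\right)$ (the interval with $\kappa=N+M$ being taken closed) and $$a=\frac{-M-1+\kappa}{N}+\frac1N\sum_{i=1}^{\infty}\frac{\xi_i}{3^{n_0(i)}4^{n_1(i)}},$$ where $(\xi_i)_{i\ge1}$ is the greedy expansion, and, with $i_0(a):=\kappa$, $$\overline{\dim}_B(F_\sigma\cap L_a)=\limsup_{k\to\infty}\frac{\log\|e_{i_0(a)}A_{\sigma_1}^{\xi_1}A_{\sigma_2}^{\xi_2}\cdots A_{\sigma_k}^{\xi_k}\|}{n_0(k)\log 3+n_1(k)\log 4},$$ $$\underline{\dim}_B(F_\sigma\cap L_a)=\liminf_{k\to\infty}\frac{\log\|e_{i_0(a)}A_{\sigma_1}^{\xi_1}A_{\sigma_2}^{\xi_2}\cdots A_{\sigma_k}^{\xi_k}\|}{n_0(k)\log 3+n_1(k)\log 4}.$$ Here $e_i$ is the $i$-th standard basis row vector of $\mathbb R^{N+M}$ and $\|\cdot\|$ denotes the sum of all entries.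
   Context: Carpet. Let $\Omega_0=\{(0,0),(0,1),(0,2),(1,0),(1,2),(2,0),(2,1),(2,2)\}$ and $\Omega_1=\{(0,0),(0,1),(0,2),(0,3),(1,0),(1,3),(2,0),(2,1),(3,0),(3,1),(3,2),(3,3)\}$; write $d=(d^1,d^2)$ for their elements. Define maps of $\mathbb R^2$ by $\Phi^0_d(x,y)=\frac{(x,y)+d}{3}$ for $d\in\Omega_0$ and $\Phi^1_d(x,y)=\frac{(x,y)+d}{4}$ for $d\in\Omega_1$. For $\sigma\in\{0,1\}^{\mathbb N}$ let $n_0(k)=\#\{1\le i\le k:\sigma_i=0\}$ and $n_1(k)=\#\{1\le i\le k:\sigma_i=1\}$. Let $F_0=[0,1]^2$, for $j\ge1$ let $F_j$ be the union of the squares $\Phi^{\sigma_1}_{d_1}\circ\cdots\circ\Phi^{\sigma_j}_{d_j}(F_0)$ over all $d_1\in\Omega_{\sigma_1},\ldots,d_j\in\Omega_{\sigma_j}$, and let $F_\sigma=\bigcap_{j\ge1}F_j$. Line. $L_a=\{(x,y)\in\mathbb R^2: y=x\tan\theta+a\}$. Matrices. These are $(N+M)\times(N+M)$ matrices with index range $1\le p,q\le N+M$: for $j\in\{0,1,2\}$, $$(A_0^j)_{pq}=\#\{d\in\Omega_0: d^1M-d^2N=2M+2+q-3p-j\},$$ and for $j\in\{0,1,2,3\}$, $$(A_1^j)_{pq}=\#\{d\in\Omega_1: d^1M-d^2N=3M+3+q-4p-j\}.$$ Greedy expansion. The digits satisfy $\xi_i\in\{0,1,2\}$ if $\sigma_i=0$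 and $\xi_i\in\{0,1,2,3\}$ if $\sigma_i=1$; successively for $i=1,2,\ldots$, $\xi_i$ is the largest allowed digit such that $\frac{-M-1+\kappa}{N}+\frac1N\sum_{l=1}^{i}\frac{\xi_l}{3^{n_0(l)}4^{n_1(l)}}\le a$. $\overline{\dim}_B$ and $\underline{\dim}_B$ are the upper and lower box-counting dimensions. *)

theory Defs
  imports "HOL-Analysis.Analysis" "Jordan_Normal_Form.Matrix"
begin

text \<open>
  Sequences indexed by the positive integers (\<open>\<sigma>\<close>, \<open>\<xi>\<close>, words \<open>d\<close>) are functions on \<^typ>\<open>nat\<close>
  whose value at 0 is never used. The alphabet is the set of natural numbers 0 and 1; the
  functions taking a symbol \<open>s\<close> treat every nonzero symbol as 1.
\<close>

subsection \<open>Box-counting dimensions\<close>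

text \<open>
  Least number of sets of diameter at most \<open>\<delta>\<close> covering \<open>F\<close>; meaningful for totally bounded \<open>F\<close>.
  Boundedness is required explicitly because \<^const>\<open>diameter\<close> is unspecified on unbounded sets.
\<close>

definition covering_number :: "'a::metric_space set \<Rightarrow> real \<Rightarrow> nat" where
  "covering_number F \<delta> =
     (LEAST n. \<exists>\<C>. finite \<C> \<and> card \<C> = n \<and> F \<subseteq> \<Union>\<C> \<and>
                  (\<forall>U\<in>\<C>. bounded U \<and> diameter U \<le> \<delta>))"

definition upper_box_dim :: "'a::metric_space set \<Rightarrow> ereal" where
  "upper_box_dim F =
     Limsup (at_right 0) (\<lambda>\<delta>. ereal (ln (real (covering_number F \<delta>)) / - ln \<delta>))"

definition lower_box_dim :: "'a::metric_space set \<Rightarrow> ereal" where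
  "lower_box_dim F =
     Liminf (at_right 0) (\<lambda>\<delta>. ereal (ln (real (covering_number F \<delta>)) / - ln \<delta>))"

subsection \<open>The carpet and the line\<close>

definition Omega0 :: "(int \<times> int) set" where
  "Omega0 = {(0,0),(0,1),(0,2),(1,0),(1,2),(2,0),(2,1),(2,2)}"

definition Omega1 :: "(int \<times> int) set" where
  "Omega1 = {(0,0),(0,1),(0,2),(0,3),(1,0),(1,3),(2,0),(2,1),(3,0),(3,1),(3,2),(3,3)}"

definition Omega :: "nat \<Rightarrow> (int \<times> int) set" where
  "Omega s = (if s = 0 then Omega0 else Omega1)"

definition base :: "nat \<Rightarrow> nat" where
  "base s = (if s = 0 then 3 else 4)"

definition Phi :: "nat \<Rightarrow> int \<times> int \<Rightarrow> real \<times> real \<Rightarrow> real \<times> real" where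
  "Phi s d = (\<lambda>(x, y). ((x + of_int (fst d)) / real (base s), (y + of_int (snd d)) / real (base s)))"

primrec Phi_comp :: "(nat \<Rightarrow> nat) \<Rightarrow> (nat \<Rightarrow> int \<times> int) \<Rightarrow> nat \<Rightarrow> real \<times> real \<Rightarrow> real \<times> real" where
  "Phi_comp \<sigma> d 0 = id"
| "Phi_comp \<sigma> d (Suc j) = Phi_comp \<sigma> d j \<circ> Phi (\<sigma> (Suc j)) (d (Suc j))"

definition carpet_level :: "(nat \<Rightarrow> nat) \<Rightarrow> nat \<Rightarrow> (real \<times> real) set" where
  "carpet_level \<sigma> j =
     (\<Union>d\<in>{d. \<forall>i\<in>{1..j}. d i \<in> Omega (\<sigma> i)}. Phi_comp \<sigma> d j ` ({0..1} \<times> {0..1}))"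

definition carpet :: "(nat \<Rightarrow> nat) \<Rightarrow> (real \<times> real) set" where
  "carpet \<sigma> = (\<Inter>j\<in>{1..}. carpet_level \<sigma> j)"

definition line :: "real \<Rightarrow> real \<Rightarrow> (real \<times> real) set" where
  "line \<theta> a = {(x, y). y = x * tan \<theta> + a}"

subsection \<open>The matrices\<close>

definition n0 :: "(nat \<Rightarrow> nat) \<Rightarrow> nat \<Rightarrow> nat" where
  "n0 \<sigma> k = card {i\<in>{1..k}. \<sigma> i = 0}"

definition n1 :: "(nat \<Rightarrow> nat) \<Rightarrow> nat \<Rightarrow> nat" where
  "n1 \<sigma> k = card {i\<in>{1..k}. \<sigma> i = 1}"

text \<open>
  The entries below are written for indices \<open>p\<close>, \<open>q\<close> running from 1 to \<open>N + M\<close>; the matrix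
  library indexes from 0, hence the shift by \<^const>\<open>Suc\<close> in \<open>A_mat\<close> and the unit vector with
  index \<open>\<kappa> - 1\<close> in \<open>row_prod\<close>.
\<close>

definition A0_entry :: "nat \<Rightarrow> nat \<Rightarrow> nat \<Rightarrow> nat \<Rightarrow> nat \<Rightarrow> nat" where
  "A0_entry M N j p q =
     card {d\<in>Omega0. fst d * int M - snd d * int N = 2 * int M + 2 + int q - 3 * int p - int j}"

definition A1_entry :: "nat \<Rightarrow> nat \<Rightarrow> nat \<Rightarrow> nat \<Rightarrow> nat \<Rightarrow> nat" where
  "A1_entry M N j p q =
     card {d\<in>Omega1. fst d * int M - snd d * int N = 3 * int M + 3 + int q - 4 * int p - int j}"

definition A_mat :: "nat \<Rightarrow> nat \<Rightarrow> nat \<Rightarrow> nat \<Rightarrow> real mat" where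
  "A_mat M N s j =
     mat (N + M) (N + M) (\<lambda>(p, q).
       real (if s = 0 then A0_entry M N j (Suc p) (Suc q) else A1_entry M N j (Suc p) (Suc q)))"

primrec A_prod :: "nat \<Rightarrow> nat \<Rightarrow> (nat \<Rightarrow> nat) \<Rightarrow> (nat \<Rightarrow> nat) \<Rightarrow> nat \<Rightarrow> real mat" where
  "A_prod M N \<sigma> \<xi> 0 = 1\<^sub>m (N + M)"
| "A_prod M N \<sigma> \<xi> (Suc k) = A_prod M N \<sigma> \<xi> k * A_mat M N (\<sigma> (Suc k)) (\<xi> (Suc k))"

definition row_prod ::
  "nat \<Rightarrow> nat \<Rightarrow> nat \<Rightarrow> (nat \<Rightarrow> nat) \<Rightarrow> (nat \<Rightarrow> nat) \<Rightarrow> nat \<Rightarrow> real mat" where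
  "row_prod M N \<kappa> \<sigma> \<xi> k = mat_of_row (unit_vec (N + M) (\<kappa> - 1)) * A_prod M N \<sigma> \<xi> k"

definition growth_quotient ::
  "nat \<Rightarrow> nat \<Rightarrow> nat \<Rightarrow> (nat \<Rightarrow> nat) \<Rightarrow> (nat \<Rightarrow> nat) \<Rightarrow> nat \<Rightarrow> real" where
  "growth_quotient M N \<kappa> \<sigma> \<xi> k =
     ln (sum_mat (row_prod M N \<kappa> \<sigma> \<xi> k)) / (real (n0 \<sigma> k) * ln 3 + real (n1 \<sigma> k) * ln 4)"

subsection \<open>The greedy expansion\<close>

definition digit_term :: "(nat \<Rightarrow> nat) \<Rightarrow> (nat \<Rightarrow> nat) \<Rightarrow> nat \<Rightarrow> real" where
  "digit_term \<sigma> \<xi> i = real (\<xi> i) / (3 ^ n0 \<sigma> i * 4 ^ n1 \<sigma> i)"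

definition strip_left :: "nat \<Rightarrow> nat \<Rightarrow> nat \<Rightarrow> real" where
  "strip_left M N \<kappa> = (- real M - 1 + real \<kappa>) / real N"

definition strip_right :: "nat \<Rightarrow> nat \<Rightarrow> nat \<Rightarrow> real" where
  "strip_right M N \<kappa> = (- real M + real \<kappa>) / real N"

definition strip :: "nat \<Rightarrow> nat \<Rightarrow> nat \<Rightarrow> real set" where
  "strip M N \<kappa> =
     (if \<kappa> = N + M then {strip_left M N \<kappa>..strip_right M N \<kappa>}
      else {strip_left M N \<kappa>..<strip_right M N \<kappa>})"

text \<open>
  Digits \<open>c\<close> that may be chosen at place \<open>i\<close>, given the digits of \<open>\<xi>\<close> at the places before \<open>i\<close>.
\<close>

definition admissible_digits ::
  "nat \<Rightarrow> nat \<Rightarrow> nat \<Rightarrow> (nat \<Rightarrow> nat) \<Rightarrow> real \<Rightarrow> (nat \<Rightarrow> nat) \<Rightarrow> nat \<Rightarrow> nat set" where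
  "admissible_digits M N \<kappa> \<sigma> a \<xi> i =
     {c. c < base (\<sigma> i) \<and>
         strip_left M N \<kappa> + 1 / real N * (\<Sum>l=1..i. digit_term \<sigma> (\<xi>(i := c)) l) \<le> a}"

definition greedy_expansion ::
  "nat \<Rightarrow> nat \<Rightarrow> nat \<Rightarrow> (nat \<Rightarrow> nat) \<Rightarrow> real \<Rightarrow> (nat \<Rightarrow> nat) \<Rightarrow> bool" where
  "greedy_expansion M N \<kappa> \<sigma> a \<xi> \<longleftrightarrow>
     (\<forall>i\<ge>1. \<xi> i \<in> admissible_digits M N \<kappa> \<sigma> a \<xi> i \<and>
            (\<forall>c\<in>admissible_digits M N \<kappa> \<sigma> a \<xi> i. c \<le> \<xi> i))"

end

theory Submission
  imports Defs "HOL-Real_Asymp.Real_Asymp"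
begin

text \<open>
  Write \<open>B\<^sub>k\<close> for the number of subdivisions of the unit interval at level \<open>k\<close>, and
  \<open>N B\<^sub>k a = D\<^sub>k + r\<^sub>k\<close> with \<open>D\<^sub>k\<close> an integer and \<open>0 \<le> r\<^sub>k \<le> 1\<close>, where the remainders \<open>r\<^sub>k\<close> are those of
  the greedy expansion. After rescaling the square with integer corner \<open>(u, v)\<close> to the unit
  square, the line has \<open>N\<close> times its intercept equal to \<open>D\<^sub>k + r\<^sub>k + u M - v N\<close>, so its position is
  determined by the integer \<open>D\<^sub>k + u M - v N + M + 1\<close>, the type of the square. The matrices record how
  types are inherited, hence the sum of the entries of the product counts the squares of level \<open>k\<close>
  with type in \<open>1..N + M\<close>.

  Each such square meets the slice, because the left and the bottom edge of every square lie in the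
  carpet and a line of nonnegative slope enters the square through one of them. Conversely the
  slice is covered by these squares together with squares of type \<open>N + M + 1\<close> that the line only
  touches (at the upper left corner if \<open>M > 0\<close>, along the top edge if \<open>M = 0\<close>); their number is at most
  \<open>12 k\<close> times as large. A factor linear in \<open>k\<close> does not influence the box dimensions.
\<close>

subsection \<open>Integer coordinates of the squares\<close>

primrec mesh :: "(nat \<Rightarrow> nat) \<Rightarrow> nat \<Rightarrow> nat" where
  "mesh \<sigma> 0 = 1"
| "mesh \<sigma> (Suc k) = base (\<sigma> (Suc k)) * mesh \<sigma> k"

text \<open>Squares are encoded by their lower left corner in units of
  \<open>1 / mesh \<sigma> k\<close>, so refining a square appends a digit in base \<open>b\<close>
  to both coordinates.\<close>

definition child :: "nat \<Rightarrow> int \<times> int \<Rightarrow> int \<times> int \<Rightarrow> int \<times> int" where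
  "child b c d = (int b * fst c + fst d, int b * snd c + snd d)"

primrec cells :: "(nat \<Rightarrow> nat) \<Rightarrow> nat \<Rightarrow> (int \<times> int) set" where
  "cells \<sigma> 0 = {(0, 0)}"
| "cells \<sigma> (Suc k) =
     (\<lambda>(c, d). child (base (\<sigma> (Suc k))) c d) ` (cells \<sigma> k \<times> Omega (\<sigma> (Suc k)))"

definition cell_square :: "(nat \<Rightarrow> nat) \<Rightarrow> nat \<Rightarrow> int \<times> int \<Rightarrow> (real \<times> real) set" where
  "cell_square \<sigma> k c =
     {(x, y). of_int (fst c) \<le> real (mesh \<sigma> k) * x \<and> real (mesh \<sigma> k) * x \<le> of_int (fst c) + 1 \<and>
              of_int (snd c) \<le> real (mesh \<sigma> k) * y \<and> real (mesh \<sigma> k) * y \<le> of_int (snd c) + 1}"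

lemma base_ge_3: "3 \<le> base s"
  by (simp add: base_def)

lemma base_le_4: "base s \<le> 4"
  by (simp add: base_def)

lemma base_pos [simp]: "0 < base s"
  by (simp add: base_def)

lemma base_neq_0 [simp]: "base s \<noteq> 0"
  by (simp add: base_def)

lemma mesh_pos [simp]: "0 < mesh \<sigma> k"
  by (induction k) simp_all

lemma mesh_neq_0 [simp]: "mesh \<sigma> k \<noteq> 0"
  using mesh_pos[of \<sigma> k] by linarith

lemma mesh_ge_power: "3 ^ k \<le> mesh \<sigma> k"
  by (induction k) (auto intro!: mult_mono base_ge_3)

lemma n0_Suc: "n0 \<sigma> (Suc k) = n0 \<sigma> k + (if \<sigma> (Suc k) = 0 then 1 else 0)"
proof -
  have "{i \<in> {1..Suc k}. \<sigma> i = 0} =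
    (if \<sigma> (Suc k) = 0 then insert (Suc k) {i \<in> {1..k}. \<sigma> i = 0} else {i \<in> {1..k}. \<sigma> i = 0})"
    by (auto simp: le_Suc_eq)
  then show ?thesis by (simp add: n0_def)
qed

lemma n1_Suc: "n1 \<sigma> (Suc k) = n1 \<sigma> k + (if \<sigma> (Suc k) = 1 then 1 else 0)"
proof -
  have "{i \<in> {1..Suc k}. \<sigma> i = 1} =
    (if \<sigma> (Suc k) = 1 then insert (Suc k) {i \<in> {1..k}. \<sigma> i = 1} else {i \<in> {1..k}. \<sigma> i = 1})"
    by (auto simp: le_Suc_eq)
  then show ?thesis by (simp add: n1_def)
qed

text \<open>The assumption on the alphabet matters: \<open>base\<close> gives every nonzero symbol
  the value 4, whereas \<open>n1\<close> counts only the symbol 1.\<close>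

lemma mesh_eq:
  assumes "\<And>i. i \<ge> 1 \<Longrightarrow> \<sigma> i \<in> {0, 1}"
  shows "mesh \<sigma> k = 3 ^ n0 \<sigma> k * 4 ^ n1 \<sigma> k"
proof (induction k)
  case 0
  then show ?case by (simp add: n0_def n1_def)
next
  case (Suc k)
  have "\<sigma> (Suc k) \<in> {0, 1}" using assms by simp
  then show ?case using Suc by (auto simp: n0_Suc n1_Suc base_def)
qed

lemma finite_Omega: "finite (Omega s)"
  by (simp add: Omega_def Omega0_def Omega1_def)

lemma card_Omega_le: "card (Omega s) \<le> 12"
  by (simp add: Omega_def Omega0_def Omega1_def)

lemma Omega_bounds:
  assumes "d \<in> Omega s"
  shows "0 \<le> fst d" "fst d \<le> int (base s) - 1" "0 \<le> snd d" "snd d \<le> int (base s) - 1"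
  using assms by (auto simp: Omega_def Omega0_def Omega1_def base_def split: if_splits)

lemma left_column_in_Omega:
  assumes "0 \<le> e" "e < int (base s)"
  shows "(0, e) \<in> Omega s"
proof -
  have "e \<in> {0, 1, 2} \<or> e = 3 \<and> s \<noteq> 0" using assms by (auto simp: base_def split: if_splits)
  then show ?thesis by (auto simp: Omega_def Omega0_def Omega1_def)
qed

lemma bottom_row_in_Omega:
  assumes "0 \<le> e" "e < int (base s)"
  shows "(e, 0) \<in> Omega s"
proof -
  have "e \<in> {0, 1, 2} \<or> e = 3 \<and> s \<noteq> 0" using assms by (auto simp: base_def split: if_splits)
  then show ?thesis by (auto simp: Omega_def Omega0_def Omega1_def)
qed

lemma finite_cells: "finite (cells \<sigma> k)"
  by (induction k) (simp_all add: finite_Omega)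

lemma cells_bounds:
  assumes "c \<in> cells \<sigma> k"
  shows "0 \<le> fst c" "fst c + 1 \<le> int (mesh \<sigma> k)" "0 \<le> snd c" "snd c + 1 \<le> int (mesh \<sigma> k)"
proof -
  have "0 \<le> fst c \<and> fst c + 1 \<le> int (mesh \<sigma> k) \<and> 0 \<le> snd c \<and> snd c + 1 \<le> int (mesh \<sigma> k)"
    using assms
  proof (induction k arbitrary: c)
    case 0
    then show ?case by simp
  next
    case (Suc k)
    let ?b = "int (base (\<sigma> (Suc k)))"
    from Suc.prems obtain c' d where c: "c = child (base (\<sigma> (Suc k))) c' d"
      and c': "c' \<in> cells \<sigma> k" and d: "d \<in> Omega (\<sigma> (Suc k))" by auto
    note IH = Suc.IH[OF c'] and D = Omega_bounds[OF d]
    have "?b * (fst c' + 1) \<le> ?b * int (mesh \<sigma> k)" "?b * (snd c' + 1) \<le> ?b * int (mesh \<sigma> k)"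
      using IH by (auto intro!: mult_left_mono)
    then show ?case using IH D by (auto simp: c child_def algebra_simps)
  qed
  then show "0 \<le> fst c" "fst c + 1 \<le> int (mesh \<sigma> k)" "0 \<le> snd c" "snd c + 1 \<le> int (mesh \<sigma> k)"
    by auto
qed

lemma digit_unique:
  fixes b u u' e e' :: int
  assumes "b * u + e = b * u' + e'" "0 \<le> e" "e \<le> b - 1" "0 \<le> e'" "e' \<le> b - 1"
  shows "u = u' \<and> e = e'"
proof -
  have "e div b = 0" "e' div b = 0" "b \<noteq> 0" using assms by (auto intro!: div_pos_pos_trivial)
  then have "(b * u + e) div b = u" "(b * u' + e') div b = u'"
    by (simp_all add: div_mult_self4)
  then show ?thesis using assms(1) by auto
qed

lemma zdiv_less:
  fixes t b n :: int
  assumes "0 < n" "t < b * n"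
  shows "t div n < b"
proof (rule ccontr)
  assume "\<not> t div n < b"
  then have "b * n \<le> t div n * n" using assms(1) by (intro mult_right_mono) auto
  also have "\<dots> \<le> t"
    using div_mult_mod_eq[of t n] pos_mod_sign[OF assms(1), of t] by linarith
  finally show False using assms(2) by simp
qed

text \<open>Digits are unique in each coordinate. This injectivity allows counts of squares to be
  computed as sums over their parents.\<close>

lemma child_eq_iff:
  assumes "d \<in> Omega s" "d' \<in> Omega s"
  shows "child (base s) c d = child (base s) c' d' \<longleftrightarrow> c = c' \<and> d = d'"
  using digit_unique[of "int (base s)" "fst c" "fst d" "fst c'" "fst d'"]
    digit_unique[of "int (base s)" "snd c" "snd d" "snd c'" "snd d'"]
    Omega_bounds[OF assms(1)] Omega_bounds[OF assms(2)]
  by (auto simp: child_def prod_eq_iff)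

lemma card_cells_le: "card (cells \<sigma> k) \<le> 12 ^ k"
proof (induction k)
  case (Suc k)
  have "card (cells \<sigma> (Suc k)) \<le> card (cells \<sigma> k \<times> Omega (\<sigma> (Suc k)))"
    unfolding cells.simps by (intro card_image_le) (simp add: finite_cells finite_Omega)
  also have "\<dots> \<le> 12 ^ k * 12"
    unfolding card_cartesian_product by (intro mult_mono Suc card_Omega_le) auto
  finally show ?case by simp
qed simp

section \<open>Carpet levels as unions of grid squares\<close>

primrec corner :: "(nat \<Rightarrow> nat) \<Rightarrow> (nat \<Rightarrow> int \<times> int) \<Rightarrow> nat \<Rightarrow> int \<times> int" where
  "corner \<sigma> d 0 = (0, 0)"
| "corner \<sigma> d (Suc k) = child (base (\<sigma> (Suc k))) (corner \<sigma> d k) (d (Suc k))"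

lemma corner_cong: "(\<And>i. 1 \<le> i \<Longrightarrow> i \<le> k \<Longrightarrow> d i = d' i) \<Longrightarrow> corner \<sigma> d k = corner \<sigma> d' k"
  by (induction k) simp_all

lemma cells_eq_corner:
  "cells \<sigma> k = (\<lambda>d. corner \<sigma> d k) ` {d. \<forall>i\<in>{1..k}. d i \<in> Omega (\<sigma> i)}"
proof (induction k)
  case 0
  then show ?case by auto
next
  case (Suc k)
  show ?case
  proof (intro equalityI subsetI)
    fix c assume "c \<in> cells \<sigma> (Suc k)"
    then obtain w e where c: "c = child (base (\<sigma> (Suc k))) (corner \<sigma> w k) e"
      and w: "\<forall>i\<in>{1..k}. w i \<in> Omega (\<sigma> i)" and e: "e \<in> Omega (\<sigma> (Suc k))"
      by (auto simp: Suc)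
    \<comment> \<open>Words are total functions of which only the places \<open>1..k\<close> count,
      so a word is extended by overwriting the next place.\<close>
    let ?w = "w(Suc k := e)"
    have "corner \<sigma> ?w k = corner \<sigma> w k" by (rule corner_cong) simp
    then have "c = corner \<sigma> ?w (Suc k)" using c by simp
    moreover have "\<forall>i\<in>{1..Suc k}. ?w i \<in> Omega (\<sigma> i)" using w e by auto
    ultimately show "c \<in> (\<lambda>d. corner \<sigma> d (Suc k)) ` {d. \<forall>i\<in>{1..Suc k}. d i \<in> Omega (\<sigma> i)}"
      by blast
  next
    fix c assume "c \<in> (\<lambda>d. corner \<sigma> d (Suc k)) ` {d. \<forall>i\<in>{1..Suc k}. d i \<in> Omega (\<sigma> i)}"
    then obtain w where c: "c = child (base (\<sigma> (Suc k))) (corner \<sigma> w k) (w (Suc k))"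
      and w: "\<forall>i\<in>{1..Suc k}. w i \<in> Omega (\<sigma> i)" by auto
    have "corner \<sigma> w k \<in> cells \<sigma> k" unfolding Suc using w by auto
    moreover have "w (Suc k) \<in> Omega (\<sigma> (Suc k))" using w by auto
    ultimately show "c \<in> cells \<sigma> (Suc k)" unfolding c by auto
  qed
qed

text \<open>A new map is composed on the inside, hence contributes the least significant digit of
  the corner, as in \<open>child\<close>.\<close>

lemma Phi_comp_eq:
  "Phi_comp \<sigma> d k (x, y) =
    ((x + of_int (fst (corner \<sigma> d k))) / real (mesh \<sigma> k),
     (y + of_int (snd (corner \<sigma> d k))) / real (mesh \<sigma> k))"
proof (induction k arbitrary: x y)
  case (Suc k)
  have "real (base (\<sigma> (Suc k))) \<noteq> 0" "real (mesh \<sigma> k) \<noteq> 0" by simp_all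
  then show ?case by (simp add: Phi_def Suc child_def field_simps)
qed simp

lemma Phi_comp_image: "Phi_comp \<sigma> d k ` ({0..1} \<times> {0..1}) = cell_square \<sigma> k (corner \<sigma> d k)"
proof (intro equalityI subsetI)
  fix p assume "p \<in> Phi_comp \<sigma> d k ` ({0..1} \<times> {0..1})"
  then show "p \<in> cell_square \<sigma> k (corner \<sigma> d k)"
    by (auto simp: cell_square_def Phi_comp_eq)
next
  fix p assume "p \<in> cell_square \<sigma> k (corner \<sigma> d k)"
  then obtain x y where p: "p = (x, y)" "(x, y) \<in> cell_square \<sigma> k (corner \<sigma> d k)"
    by (cases p) auto
  let ?q = "(real (mesh \<sigma> k) * x - of_int (fst (corner \<sigma> d k)),
             real (mesh \<sigma> k) * y - of_int (snd (corner \<sigma> d k)))"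
  have "p = Phi_comp \<sigma> d k ?q" unfolding Phi_comp_eq p by simp
  moreover have "?q \<in> {0..1} \<times> {0..1}" using p by (auto simp: cell_square_def)
  ultimately show "p \<in> Phi_comp \<sigma> d k ` ({0..1} \<times> {0..1})" by (rule image_eqI)
qed

lemma carpet_level_eq: "carpet_level \<sigma> k = (\<Union>c\<in>cells \<sigma> k. cell_square \<sigma> k c)"
  by (simp add: carpet_level_def Phi_comp_image cells_eq_corner)

lemma cell_square_child_subset:
  assumes "d \<in> Omega (\<sigma> (Suc k))"
  shows "cell_square \<sigma> (Suc k) (child (base (\<sigma> (Suc k))) c d) \<subseteq> cell_square \<sigma> k c"
proof -
  define b where "b = base (\<sigma> (Suc k))"
  have b: "0 < real b" by (simp add: b_def)
  have aux: "of_int u \<le> s * x \<and> s * x \<le> of_int u + 1"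
    if "of_int (int b * u + e) \<le> real b * s * x" "real b * s * x \<le> of_int (int b * u + e) + 1"
      "0 \<le> e" "e \<le> int b - 1" for u e and s x :: real
  proof -
    have "0 \<le> real_of_int e" "real_of_int e \<le> real b - 1"
      using \<open>0 \<le> e\<close> \<open>e \<le> int b - 1\<close> by linarith+
    moreover have "real b * of_int u + of_int e \<le> real b * (s * x)"
      "real b * (s * x) \<le> real b * of_int u + of_int e + 1"
      using that(1,2) by (simp_all add: mult.assoc)
    ultimately have "real b * of_int u \<le> real b * (s * x)" "real b * (s * x) \<le> real b * (of_int u + 1)"
      unfolding distrib_left by linarith+
    then show ?thesis using b by (simp only: mult_le_cancel_left_pos)
  qed
  have B: "0 \<le> fst d" "fst d \<le> int b - 1" "0 \<le> snd d" "snd d \<le> int b - 1"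
    using Omega_bounds[OF assms] by (simp_all add: b_def)
  have sc: "real (mesh \<sigma> (Suc k)) = real b * real (mesh \<sigma> k)" by (simp add: b_def)
  show ?thesis
  proof (rule subsetI, goal_cases)
    case (1 p)
    obtain x y where p: "p = (x, y)" by (cases p)
    have "of_int (fst c) \<le> real (mesh \<sigma> k) * x \<and> real (mesh \<sigma> k) * x \<le> of_int (fst c) + 1"
      using 1 B by (intro aux[of _ "fst d"]) (simp_all only: p cell_square_def child_def b_def[symmetric] sc
          mem_Collect_eq split_conv fst_conv snd_conv)
    moreover have "of_int (snd c) \<le> real (mesh \<sigma> k) * y \<and> real (mesh \<sigma> k) * y \<le> of_int (snd c) + 1"
      using 1 B by (intro aux[of _ "snd d"]) (simp_all only: p cell_square_def child_def b_def[symmetric] sc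
          mem_Collect_eq split_conv fst_conv snd_conv)
    ultimately show ?case by (simp add: p cell_square_def)
  qed
qed

lemma carpet_level_Suc_subset: "carpet_level \<sigma> (Suc k) \<subseteq> carpet_level \<sigma> k"
  unfolding carpet_level_eq using cell_square_child_subset by fastforce

lemma carpet_subset_level: "carpet \<sigma> \<subseteq> carpet_level \<sigma> k"
proof (cases k)
  case 0
  \<comment> \<open>\<open>carpet\<close> intersects the levels from 1 on, so level 0 is reached
    through level 1.\<close>
  have "carpet \<sigma> \<subseteq> carpet_level \<sigma> (Suc 0)" by (auto simp: carpet_def)
  then show ?thesis using carpet_level_Suc_subset[of \<sigma> 0] 0 by auto
next
  case (Suc j)
  then show ?thesis by (auto simp: carpet_def)
qed

text \<open>
  The digit sets contain the whole left column and the whole bottom row (but \<^const>\<open>Omega1\<close> not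
  the whole top row), so the left and the bottom edge of every square survive in the carpet.
\<close>

lemma subdivide_edge:
  fixes z :: real and v :: int and b :: nat
  assumes "of_int v \<le> z" "z \<le> of_int v + 1" "0 < b"
  shows "\<exists>e. 0 \<le> e \<and> e < int b \<and> of_int (int b * v + e) \<le> real b * z \<and>
    real b * z \<le> of_int (int b * v + e) + 1"
proof -
  \<comment> \<open>The cap is needed at the far end \<open>z = v + 1\<close>, where the floor
    equals \<open>b\<close> and is no digit.\<close>
  define e where "e = min (int b - 1) \<lfloor>real b * (z - of_int v)\<rfloor>"
  have 1: "0 \<le> real b * (z - of_int v)" using assms by simp
  have 2: "real b * (z - of_int v) \<le> real b * 1" using assms by (intro mult_left_mono) auto
  have f: "of_int \<lfloor>real b * (z - of_int v)\<rfloor> \<le> real b * (z - of_int v)"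
    "real b * (z - of_int v) < of_int \<lfloor>real b * (z - of_int v)\<rfloor> + 1" by linarith+
  have "0 \<le> e" "e < int b" using assms 1 by (auto simp: e_def)
  moreover have "of_int e \<le> real b * (z - of_int v)"
    using f unfolding e_def by linarith
  moreover have "real b * (z - of_int v) \<le> of_int e + 1"
    using f 2 unfolding e_def min_def by auto
  ultimately show ?thesis by (intro exI[of _ e]) (auto simp: algebra_simps)
qed

definition on_left_edge :: "(nat \<Rightarrow> nat) \<Rightarrow> nat \<Rightarrow> real \<times> real \<Rightarrow> bool" where
  "on_left_edge \<sigma> k p \<longleftrightarrow>
     (\<exists>c\<in>cells \<sigma> k. p \<in> cell_square \<sigma> k c \<and> real (mesh \<sigma> k) * fst p = of_int (fst c))"

definition on_bottom_edge :: "(nat \<Rightarrow> nat) \<Rightarrow> nat \<Rightarrow> real \<times> real \<Rightarrow> bool" where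
  "on_bottom_edge \<sigma> k p \<longleftrightarrow>
     (\<exists>c\<in>cells \<sigma> k. p \<in> cell_square \<sigma> k c \<and> real (mesh \<sigma> k) * snd p = of_int (snd c))"

text \<open>The point stays on the left edge of the child in column 0 whose row contains it, and the
  left column of digits is complete.\<close>

lemma on_left_edge_Suc:
  assumes "on_left_edge \<sigma> k p"
  shows "on_left_edge \<sigma> (Suc k) p"
proof -
  define b where "b = base (\<sigma> (Suc k))"
  obtain x y where p: "p = (x, y)" by (cases p)
  from assms obtain c where c: "c \<in> cells \<sigma> k" "(x, y) \<in> cell_square \<sigma> k c"
    "real (mesh \<sigma> k) * x = of_int (fst c)" by (auto simp: on_left_edge_def p)
  obtain e where e: "0 \<le> e" "e < int b" "of_int (int b * snd c + e) \<le> real b * (real (mesh \<sigma> k) * y)"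
    "real b * (real (mesh \<sigma> k) * y) \<le> of_int (int b * snd c + e) + 1"
    using subdivide_edge[of "snd c" "real (mesh \<sigma> k) * y" b] c(2)
    by (auto simp: cell_square_def b_def)
  have "child b c (0, e) \<in> cells \<sigma> (Suc k)"
    using c(1) left_column_in_Omega[of e "\<sigma> (Suc k)"] e(1,2)
    by (auto simp: b_def intro!: image_eqI[where x = "(c, 0, e)"])
  moreover have x: "real b * real (mesh \<sigma> k) * x = of_int (int b * fst c)" using c(3) by simp
  moreover have "p \<in> cell_square \<sigma> (Suc k) (child b c (0, e))"
    using e x by (simp add: cell_square_def p child_def b_def[symmetric] mult.assoc)
  ultimately show ?thesis
    unfolding on_left_edge_def by (intro bexI[of _ "child b c (0, e)"]) (auto simp: p child_def b_def)
qed

lemma on_bottom_edge_Suc: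
  assumes "on_bottom_edge \<sigma> k p"
  shows "on_bottom_edge \<sigma> (Suc k) p"
proof -
  define b where "b = base (\<sigma> (Suc k))"
  obtain x y where p: "p = (x, y)" by (cases p)
  from assms obtain c where c: "c \<in> cells \<sigma> k" "(x, y) \<in> cell_square \<sigma> k c"
    "real (mesh \<sigma> k) * y = of_int (snd c)" by (auto simp: on_bottom_edge_def p)
  obtain e where e: "0 \<le> e" "e < int b" "of_int (int b * fst c + e) \<le> real b * (real (mesh \<sigma> k) * x)"
    "real b * (real (mesh \<sigma> k) * x) \<le> of_int (int b * fst c + e) + 1"
    using subdivide_edge[of "fst c" "real (mesh \<sigma> k) * x" b] c(2)
    by (auto simp: cell_square_def b_def)
  have "child b c (e, 0) \<in> cells \<sigma> (Suc k)"
    using c(1) bottom_row_in_Omega[of e "\<sigma> (Suc k)"] e(1,2)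
    by (auto simp: b_def intro!: image_eqI[where x = "(c, e, 0)"])
  moreover have y: "real b * real (mesh \<sigma> k) * y = of_int (int b * snd c)" using c(3) by simp
  moreover have "p \<in> cell_square \<sigma> (Suc k) (child b c (e, 0))"
    using e y by (simp add: cell_square_def p child_def b_def[symmetric] mult.assoc)
  ultimately show ?thesis
    unfolding on_bottom_edge_def by (intro bexI[of _ "child b c (e, 0)"]) (auto simp: p child_def b_def)
qed

lemma edge_subset_carpet:
  assumes "on_left_edge \<sigma> k p \<or> on_bottom_edge \<sigma> k p"
  shows "p \<in> carpet \<sigma>"
proof -
  have edge: "on_left_edge \<sigma> (k + m) p \<or> on_bottom_edge \<sigma> (k + m) p" for m
    by (induction m) (use assms in \<open>auto intro: on_left_edge_Suc on_bottom_edge_Suc\<close>)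
  have "p \<in> carpet_level \<sigma> j" for j
  proof -
    \<comment> \<open>Level \<open>k + j\<close> is at least \<open>k\<close>, where the edge
      property is known, and at least \<open>j\<close>; the levels decrease.\<close>
    have "p \<in> carpet_level \<sigma> (k + j)"
      using edge[of j] by (auto simp: carpet_level_eq on_left_edge_def on_bottom_edge_def)
    also have "carpet_level \<sigma> (k + j) \<subseteq> carpet_level \<sigma> j"
      using decseqD[of "carpet_level \<sigma>" j "k + j"] carpet_level_Suc_subset[of \<sigma>]
      by (simp add: decseq_SucI)
    finally show ?thesis .
  qed
  then show ?thesis by (simp add: carpet_def)
qed

subsection \<open>Counting squares with the matrices\<close>

text \<open>With \<open>h = cell_type M N D c - M - 1 + r\<close>, the line rescaled to the square
  is \<open>N * y = M * x + h\<close>; it meets the unit square exactly for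
  \<open>- M \<le> h \<le> N\<close>. Types in \<open>1..N + M\<close> satisfy this for every
  \<open>r\<close> between 0 and 1.\<close>

definition cell_type :: "nat \<Rightarrow> nat \<Rightarrow> int \<Rightarrow> int \<times> int \<Rightarrow> int" where
  "cell_type M N D c = D + fst c * int M - snd c * int N + int M + 1"

text \<open>
  \<open>D k\<close> and \<open>r k\<close> are the integer part and the remainder of \<open>N B\<^sub>k a\<close>; the remainder equals 1 only
  for \<open>a = 1\<close>, where the last strip is closed.
\<close>

locale carpet_slice =
  fixes M N :: nat and \<sigma> \<xi> :: "nat \<Rightarrow> nat" and a :: real and \<kappa> :: nat
    and D :: "nat \<Rightarrow> int" and r :: "nat \<Rightarrow> real"
  assumes N: "N \<ge> 1"
    and \<kappa>: "\<kappa> \<in> {1..N + M}"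
    and D_0: "D 0 = int \<kappa> - int M - 1"
    and D_Suc: "\<And>k. D (Suc k) = int (base (\<sigma> (Suc k))) * D k + int (\<xi> (Suc k))"
    and digit_less: "\<And>k. \<xi> (Suc k) < base (\<sigma> (Suc k))"
    and D_r: "\<And>k. real N * real (mesh \<sigma> k) * a = of_int (D k) + r k"
    and r_range: "\<And>k. 0 \<le> r k" "\<And>k. r k \<le> 1"
    and r_less_1: "\<And>k. a < 1 \<Longrightarrow> r k < 1"
    and a_le_1: "a \<le> 1"
begin

abbreviation type_of :: "nat \<Rightarrow> int \<times> int \<Rightarrow> int" where
  "type_of k \<equiv> cell_type M N (D k)"

text \<open>The type of a child depends on the parent only through the parent's type. This is why a
  matrix indexed by types describes the refinement.\<close>

lemma type_of_child:
  "type_of (Suc k) (child (base (\<sigma> (Suc k))) c d) =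
    int (base (\<sigma> (Suc k))) * (type_of k c - int M - 1) + int (\<xi> (Suc k)) +
    (fst d * int M - snd d * int N) + int M + 1"
  by (simp add: cell_type_def child_def D_Suc algebra_simps)

definition hit_cells :: "nat \<Rightarrow> (int \<times> int) set" where
  "hit_cells k = {c \<in> cells \<sigma> k. type_of k c \<in> {1..int (N + M)}}"

text \<open>Type \<open>N + M + 1\<close> corresponds to \<open>h = N + r k\<close>, so the line
  meets such a square only if the remainder vanishes.\<close>

definition touch_cells :: "nat \<Rightarrow> (int \<times> int) set" where
  "touch_cells k = {c \<in> cells \<sigma> k. type_of k c = int (N + M) + 1 \<and> r k = 0}"

lemma finite_hit_cells: "finite (hit_cells k)" and finite_touch_cells: "finite (touch_cells k)"
  by (simp_all add: hit_cells_def touch_cells_def finite_cells)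

lemma step_bounds:
  assumes "d \<in> Omega s"
  shows "- (int (base s) - 1) * int N \<le> fst d * int M - snd d * int N"
    "fst d * int M - snd d * int N \<le> (int (base s) - 1) * int M"
proof -
  note B = Omega_bounds[OF assms]
  have "0 \<le> fst d * int M" "0 \<le> snd d * int N" using B by auto
  moreover have "fst d * int M \<le> (int (base s) - 1) * int M" "snd d * int N \<le> (int (base s) - 1) * int N"
    using B by (auto intro!: mult_right_mono)
  ultimately show "- (int (base s) - 1) * int N \<le> fst d * int M - snd d * int N"
    "fst d * int M - snd d * int N \<le> (int (base s) - 1) * int M"
    by (simp_all only: mult_minus_left)
qed

text \<open>If the parent had type at most 0, then \<open>b\<close> times its shifted type would be
  at most \<open>- b * M - b\<close>; the digit adds at most \<open>b - 1\<close> and the step at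
  most \<open>(b - 1) * M\<close>, which leaves a child of type at most 0.\<close>

lemma type_of_parent_ge:
  assumes "d \<in> Omega (\<sigma> (Suc k))"
    and "1 \<le> type_of (Suc k) (child (base (\<sigma> (Suc k))) c d)"
  shows "1 \<le> type_of k c"
proof (rule ccontr)
  let ?b = "int (base (\<sigma> (Suc k)))"
  assume "\<not> 1 \<le> type_of k c"
  then have "?b * (type_of k c - int M - 1) \<le> ?b * (- int M - 1)"
    by (intro mult_left_mono) auto
  then have "?b * (type_of k c - int M - 1) \<le> - (?b * int M) - ?b"
    by (simp add: right_diff_distrib)
  moreover have "fst d * int M - snd d * int N \<le> ?b * int M - int M"
    using step_bounds(2)[OF assms(1)] by (simp add: left_diff_distrib)
  moreover have "int (\<xi> (Suc k)) < ?b" using digit_less[of k] by simp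
  ultimately show False
    using assms(2) unfolding type_of_child by simp
qed

text \<open>Parents of type \<open>N + M + 2\<close> or more only have children of type above
  \<open>N + M + 1\<close>, since multiplication by \<open>b\<close> outweighs the most negative
  step \<open>- (b - 1) * N\<close>. For type \<open>N + M + 1\<close> the balance is exact, which
  forces digit 0 and the minimal step.\<close>

lemma type_of_parent_le:
  assumes "d \<in> Omega (\<sigma> (Suc k))"
    and "type_of (Suc k) (child (base (\<sigma> (Suc k))) c d) \<le> int (N + M) + 1"
  shows "type_of k c \<le> int (N + M) \<or>
    (type_of k c = int (N + M) + 1 \<and> \<xi> (Suc k) = 0 \<and>
     fst d * int M - snd d * int N = - (int (base (\<sigma> (Suc k))) - 1) * int N \<and>
     type_of (Suc k) (child (base (\<sigma> (Suc k))) c d) = int (N + M) + 1)"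
proof (cases "type_of k c \<le> int (N + M)")
  case False
  let ?b = "int (base (\<sigma> (Suc k)))"
  have b: "0 < ?b" by simp
  note T = assms(2)[unfolded type_of_child]
  note S = step_bounds(1)[OF assms(1)]
  have eq: "?b * (int N + 1) = ?b * int N + ?b" "- (?b - 1) * int N = int N - ?b * int N"
    by (simp_all add: algebra_simps)
  have "type_of k c = int (N + M) + 1"
  proof (rule ccontr)
    assume "type_of k c \<noteq> int (N + M) + 1"
    then have "?b * (int N + 1) \<le> ?b * (type_of k c - int M - 1)"
      using False by (intro mult_left_mono) auto
    then show False using T S b eq by simp
  qed
  then have "?b * (type_of k c - int M - 1) = ?b * int N" by simp
  then show ?thesis using T S eq \<open>type_of k c = int (N + M) + 1\<close> unfolding type_of_child by auto
qed simp

lemma type_of_parent_hit: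
  assumes "d \<in> Omega (\<sigma> (Suc k))"
    and "type_of (Suc k) (child (base (\<sigma> (Suc k))) c d) \<in> {1..int (N + M)}"
  shows "type_of k c \<in> {1..int (N + M)}"
  using type_of_parent_ge[OF assms(1), of c] type_of_parent_le[OF assms(1), of c] assms(2) by auto

text \<open>Row \<open>p\<close> and column \<open>q\<close>, counted from 0, stand for types
  \<open>p + 1\<close> and \<open>q + 1\<close>; the condition is \<open>type_of_child\<close> for
  such a parent and child.\<close>

lemma A_mat_entry:
  assumes "p < N + M" "q < N + M"
  shows "A_mat M N (\<sigma> (Suc k)) (\<xi> (Suc k)) $$ (p, q) =
    real (card {d \<in> Omega (\<sigma> (Suc k)). int (base (\<sigma> (Suc k))) * (int p - int M) + int (\<xi> (Suc k)) +
      (fst d * int M - snd d * int N) + int M = int q})"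
proof -
  have "{d \<in> Omega (\<sigma> (Suc k)). int (base (\<sigma> (Suc k))) * (int p - int M) + int (\<xi> (Suc k)) +
      (fst d * int M - snd d * int N) + int M = int q} =
    (if \<sigma> (Suc k) = 0
     then {d \<in> Omega0. fst d * int M - snd d * int N =
        2 * int M + 2 + int (Suc q) - 3 * int (Suc p) - int (\<xi> (Suc k))}
     else {d \<in> Omega1. fst d * int M - snd d * int N =
        3 * int M + 3 + int (Suc q) - 4 * int (Suc p) - int (\<xi> (Suc k))})"
    by (auto simp: Omega_def base_def)
  then show ?thesis
    using assms by (simp add: A_mat_def A0_entry_def A1_entry_def)
qed

lemma row_prod_Suc:
  "row_prod M N \<kappa> \<sigma> \<xi> (Suc k) = row_prod M N \<kappa> \<sigma> \<xi> k * A_mat M N (\<sigma> (Suc k)) (\<xi> (Suc k))"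
  and row_prod_carrier: "row_prod M N \<kappa> \<sigma> \<xi> k \<in> carrier_mat 1 (N + M)"
proof -
  have A: "A_mat M N s j \<in> carrier_mat (N + M) (N + M)" for s j by (simp add: A_mat_def)
  have P: "A_prod M N \<sigma> \<xi> k \<in> carrier_mat (N + M) (N + M)" for k
    by (induction k) (auto intro: mult_carrier_mat A)
  have e: "mat_of_row (unit_vec (N + M) (\<kappa> - 1)) \<in> carrier_mat 1 (N + M)"
    by (auto intro: mat_of_row_carrier)
  show "row_prod M N \<kappa> \<sigma> \<xi> k \<in> carrier_mat 1 (N + M)"
    unfolding row_prod_def using e P by (rule mult_carrier_mat)
  show "row_prod M N \<kappa> \<sigma> \<xi> (Suc k) = row_prod M N \<kappa> \<sigma> \<xi> k * A_mat M N (\<sigma> (Suc k)) (\<xi> (Suc k))"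
    unfolding row_prod_def A_prod.simps by (rule assoc_mult_mat[symmetric, OF e P A])
qed

text \<open>Sorting the children by the type of the parent gives one vector-matrix product.
  Restricting the sum to parent types \<open>1..N + M\<close> loses nothing by
  \<open>type_of_parent_hit\<close>.\<close>

lemma card_type_Suc:
  assumes "q < N + M"
  shows "card {c \<in> cells \<sigma> (Suc k). type_of (Suc k) c = int q + 1} =
    (\<Sum>p<N + M. card {c \<in> cells \<sigma> k. type_of k c = int p + 1} *
      card {d \<in> Omega (\<sigma> (Suc k)). int (base (\<sigma> (Suc k))) * (int p - int M) + int (\<xi> (Suc k)) +
      (fst d * int M - snd d * int N) + int M = int q})"
    (is "card ?L = (\<Sum>p<N + M. card (?C p) * card (?O p))")
proof -
  let ?s = "\<sigma> (Suc k)"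
  let ?f = "\<lambda>(c, d). child (base ?s) c d"
  let ?S = "\<Union>p\<in>{..<N + M}. ?C p \<times> ?O p"
  have "?L = ?f ` ?S"
  proof (intro equalityI subsetI)
    fix x assume x: "x \<in> ?L"
    then obtain c d where cd: "x = child (base ?s) c d" "c \<in> cells \<sigma> k" "d \<in> Omega ?s" by auto
    have "type_of k c \<in> {1..int (N + M)}"
      using type_of_parent_hit[OF cd(3)] x assms unfolding cd(1) by auto
    then have "type_of k c = int (nat (type_of k c - 1)) + 1 \<and> nat (type_of k c - 1) < N + M"
      by auto
    then obtain p where p: "type_of k c = int p + 1" "p < N + M" by blast
    have "type_of (Suc k) x = int q + 1" using x by simp
    then have "d \<in> ?O p" using cd(3) p(1) unfolding cd(1) type_of_child by simp
    moreover have "c \<in> ?C p" using p(1) cd(2) by simp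
    ultimately have "(c, d) \<in> ?S" using p(2) by blast
    then show "x \<in> ?f ` ?S" unfolding cd(1) by (rule rev_image_eqI) simp
  next
    fix x assume "x \<in> ?f ` ?S"
    then obtain p c d where cd: "x = child (base ?s) c d" "c \<in> ?C p" "d \<in> ?O p" by auto
    then have "type_of (Suc k) x = int q + 1" unfolding cd(1) type_of_child by simp
    then show "x \<in> ?L" using cd by auto
  qed
  moreover have "inj_on ?f ?S"
    by (rule inj_onI) (auto simp: child_eq_iff)
  ultimately have "card ?L = card ?S" by (simp add: card_image)
  also have "\<dots> = (\<Sum>p<N + M. card (?C p \<times> ?O p))"
    by (rule card_UN_disjoint) (auto simp: finite_cells finite_Omega)
  finally show ?thesis by (simp add: card_cartesian_product)
qed

lemma row_prod_entry:
  assumes "q < N + M"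
  shows "row_prod M N \<kappa> \<sigma> \<xi> k $$ (0, q) = real (card {c \<in> cells \<sigma> k. type_of k c = int q + 1})"
  using assms
proof (induction k arbitrary: q)
  case 0
  have "row_prod M N \<kappa> \<sigma> \<xi> 0 = mat_of_row (unit_vec (N + M) (\<kappa> - 1))"
    unfolding row_prod_def A_prod.simps by (rule right_mult_one_mat) (auto intro: mat_of_row_carrier)
  \<comment> \<open>The unit square has type \<open>D 0 + M + 1 = \<kappa>\<close>, which is index
    \<open>\<kappa> - 1\<close> counted from 0.\<close>
  moreover have "{c \<in> cells \<sigma> 0. type_of 0 c = int q + 1} = (if q = \<kappa> - 1 then {(0, 0)} else {})"
    using \<kappa> by (auto simp: cell_type_def D_0)
  ultimately show ?case using 0 by (simp add: mat_of_row_def unit_vec_def)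
next
  case (Suc k)
  let ?R = "row_prod M N \<kappa> \<sigma> \<xi> k" and ?A = "A_mat M N (\<sigma> (Suc k)) (\<xi> (Suc k))"
  have "(?R * ?A) $$ (0, q) = (\<Sum>p<N + M. ?R $$ (0, p) * ?A $$ (p, q))"
    using row_prod_carrier[of k] Suc.prems
    by (simp add: times_mat_def scalar_prod_def A_mat_def lessThan_atLeast0)
  also have "\<dots> = real (card {c \<in> cells \<sigma> (Suc k). type_of (Suc k) c = int q + 1})"
    unfolding card_type_Suc[OF Suc.prems] of_nat_sum of_nat_mult
    by (rule sum.cong) (auto simp: Suc.IH Suc.prems A_mat_entry)
  finally show ?case by (simp add: row_prod_Suc)
qed

lemma sum_mat_row_prod: "sum_mat (row_prod M N \<kappa> \<sigma> \<xi> k) = real (card (hit_cells k))"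
proof -
  have "hit_cells k = (\<Union>q\<in>{..<N + M}. {c \<in> cells \<sigma> k. type_of k c = int q + 1})"
  proof (intro equalityI subsetI)
    fix c assume c: "c \<in> hit_cells k"
    then have "nat (type_of k c - 1) < N + M" "type_of k c = int (nat (type_of k c - 1)) + 1"
      by (auto simp: hit_cells_def)
    then show "c \<in> (\<Union>q\<in>{..<N + M}. {c \<in> cells \<sigma> k. type_of k c = int q + 1})"
      using c by (intro UN_I[of "nat (type_of k c - 1)"]) (auto simp: hit_cells_def)
  qed (auto simp: hit_cells_def)
  then have "card (hit_cells k) = (\<Sum>q<N + M. card {c \<in> cells \<sigma> k. type_of k c = int q + 1})"
    by (simp only:) (rule card_UN_disjoint, auto simp: finite_cells)
  moreover have "sum_mat (row_prod M N \<kappa> \<sigma> \<xi> k) = (\<Sum>q<N + M. row_prod M N \<kappa> \<sigma> \<xi> k $$ (0, q))"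
  proof -
    have "{0..<1} \<times> {0..<N + M} = Pair (0::nat) ` {..<N + M}" by auto
    moreover have "dim_row (row_prod M N \<kappa> \<sigma> \<xi> k) = 1" "dim_col (row_prod M N \<kappa> \<sigma> \<xi> k) = N + M"
      using row_prod_carrier[of k] by auto
    ultimately show ?thesis by (simp only: sum_mat_def) (simp add: sum.reindex inj_on_def)
  qed
  ultimately show ?thesis by (simp add: row_prod_entry)
qed

subsection \<open>Growth of the number of squares\<close>

text \<open>A discrete form of following the line: from type \<open>M + 1\<close> on it enters
  through the left edge, below that through the bottom edge. The child at the entry point lies in
  the full left column or bottom row, and its place there is a quotient by \<open>N\<close> or
  \<open>M\<close>.\<close>

lemma type_of_child_hit:
  assumes "type_of k c \<in> {1..int (N + M)}"
  shows "\<exists>d\<in>Omega (\<sigma> (Suc k)). type_of (Suc k) (child (base (\<sigma> (Suc k))) c d) \<in> {1..int (N + M)}"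
proof -
  define b where "b = int (base (\<sigma> (Suc k)))"
  define t where "t = b * (type_of k c - int M - 1) + int (\<xi> (Suc k))"
  have b: "0 < b" and \<xi>: "int (\<xi> (Suc k)) < b" using digit_less[of k] by (simp_all add: b_def)
  show ?thesis
  proof (cases "int M + 1 \<le> type_of k c")
    case True
    have "b * (type_of k c - int M - 1) \<le> b * (int N - 1)"
      using assms b by (intro mult_left_mono) auto
    then have "t < b * int N" using \<xi> by (simp add: t_def algebra_simps)
    moreover have t: "0 \<le> t" using True b by (simp add: t_def)
    ultimately have e: "0 \<le> t div int N" "t div int N < b"
      using N by (auto simp: pos_imp_zdiv_nonneg_iff intro!: zdiv_less)
    have "type_of (Suc k) (child (base (\<sigma> (Suc k))) c (0, t div int N)) = t mod int N + int M + 1"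
      unfolding type_of_child b_def[symmetric] t_def[symmetric]
      by (simp add: minus_div_mult_eq_mod[symmetric])
    moreover have "0 \<le> t mod int N" "t mod int N < int N" using N by simp_all
    ultimately show ?thesis
      using left_column_in_Omega[of "t div int N" "\<sigma> (Suc k)"] e
      by (intro bexI[of _ "(0, t div int N)"]) (auto simp: b_def)
  next
    case False
    then have M: "0 < int M" using assms by auto
    have "b * (type_of k c - int M - 1) \<le> b * (-1)"
      using False b by (intro mult_left_mono) auto
    \<comment> \<open>\<open>- t\<close> can reach \<open>b * M\<close>, whose quotient by
      \<open>M\<close> would be no digit. After subtracting 1 the quotient stays below
      \<open>b\<close>, and the type becomes \<open>M\<close> minus the remainder.\<close>
    then have t: "0 \<le> - t - 1" using \<xi> by (simp add: t_def)
    have "b * (- int M) \<le> b * (type_of k c - int M - 1)"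
      using assms b by (intro mult_left_mono) auto
    then have "- t - 1 < b * int M" by (simp add: t_def)
    then have e: "0 \<le> (- t - 1) div int M" "(- t - 1) div int M < b"
      using M t by (auto simp: pos_imp_zdiv_nonneg_iff intro!: zdiv_less)
    have "type_of (Suc k) (child (base (\<sigma> (Suc k))) c ((- t - 1) div int M, 0)) =
      int M - (- t - 1) mod int M"
      unfolding type_of_child b_def[symmetric] t_def[symmetric]
      by (simp add: minus_div_mult_eq_mod[symmetric])
    moreover have "0 \<le> (- t - 1) mod int M" "(- t - 1) mod int M < int M" using M by simp_all
    ultimately show ?thesis
      using bottom_row_in_Omega[of "(- t - 1) div int M" "\<sigma> (Suc k)"] e
      by (intro bexI[of _ "((- t - 1) div int M, 0)"]) (auto simp: b_def)
  qed
qed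

text \<open>Pairs of a hit square and a digit leading to a hit child inject into the next
  generation, so a uniform lower bound per square multiplies the count.\<close>

lemma card_hit_cells_ge:
  assumes "\<And>c. c \<in> hit_cells k \<Longrightarrow> m \<le> card {d \<in> Omega (\<sigma> (Suc k)).
    child (base (\<sigma> (Suc k))) c d \<in> hit_cells (Suc k)}"
  shows "m * card (hit_cells k) \<le> card (hit_cells (Suc k))"
proof -
  let ?s = "\<sigma> (Suc k)"
  let ?O = "\<lambda>c. {d \<in> Omega ?s. child (base ?s) c d \<in> hit_cells (Suc k)}"
  let ?S = "SIGMA c:hit_cells k. ?O c"
  have "m * card (hit_cells k) \<le> (\<Sum>c\<in>hit_cells k. card (?O c))"
    using sum_bounded_below[of "hit_cells k" m "\<lambda>c. card (?O c)"] assms by (simp add: mult.commute)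
  also have "\<dots> = card ?S" by (simp add: finite_hit_cells finite_Omega)
  also have "\<dots> \<le> card (hit_cells (Suc k))"
    by (rule card_inj_on_le[where f = "\<lambda>(c, d). child (base ?s) c d"])
      (auto simp: inj_on_def child_eq_iff finite_hit_cells)
  finally show ?thesis .
qed

lemma card_hit_cells_mono: "card (hit_cells k) \<le> card (hit_cells (Suc k))"
proof -
  have "1 \<le> card {d \<in> Omega (\<sigma> (Suc k)). child (base (\<sigma> (Suc k))) c d \<in> hit_cells (Suc k)}"
    if c: "c \<in> hit_cells k" for c
  proof -
    obtain d where "d \<in> Omega (\<sigma> (Suc k))"
      "type_of (Suc k) (child (base (\<sigma> (Suc k))) c d) \<in> {1..int (N + M)}"
      using type_of_child_hit[of k c] c by (auto simp: hit_cells_def)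
    then have "{d} \<subseteq> {d \<in> Omega (\<sigma> (Suc k)). child (base (\<sigma> (Suc k))) c d \<in> hit_cells (Suc k)}"
      using c by (auto simp: hit_cells_def)
    from card_mono[OF _ this] show ?thesis by (simp add: finite_Omega)
  qed
  from card_hit_cells_ge[OF this] show ?thesis by simp
qed

lemma card_hit_cells_pos: "0 < card (hit_cells k)"
proof (induction k)
  case 0
  have "hit_cells 0 = {(0, 0)}" using \<kappa> by (auto simp: hit_cells_def cell_type_def D_0)
  then show ?case by simp
next
  case (Suc k)
  then show ?case using card_hit_cells_mono[of k] by linarith
qed

lemma card_hit_cells_le: "card (hit_cells (Suc k)) \<le> 12 * card (hit_cells k)"
proof -
  let ?f = "\<lambda>(c, d). child (base (\<sigma> (Suc k))) c d"
  have "hit_cells (Suc k) \<subseteq> ?f ` (hit_cells k \<times> Omega (\<sigma> (Suc k)))"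
  proof
    fix x assume x: "x \<in> hit_cells (Suc k)"
    then obtain c d where cd: "x = child (base (\<sigma> (Suc k))) c d" "c \<in> cells \<sigma> k" "d \<in> Omega (\<sigma> (Suc k))"
      by (auto simp: hit_cells_def)
    then have "c \<in> hit_cells k" using type_of_parent_hit[OF cd(3)] x by (auto simp: hit_cells_def)
    then show "x \<in> ?f ` (hit_cells k \<times> Omega (\<sigma> (Suc k)))" using cd by auto
  qed
  then have "card (hit_cells (Suc k)) \<le> card (hit_cells k \<times> Omega (\<sigma> (Suc k)))"
    by (rule surj_card_le[rotated]) (simp add: finite_hit_cells finite_Omega)
  also have "\<dots> \<le> card (hit_cells k) * 12"
    unfolding card_cartesian_product by (intro mult_left_mono card_Omega_le) simp
  finally show ?thesis by simp
qed

section \<open>Squares that the line only touches\<close>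

definition touch_digits :: "nat \<Rightarrow> (int \<times> int) set" where
  "touch_digits s = {d \<in> Omega s. fst d * int M - snd d * int N = - (int (base s) - 1) * int N}"

lemma touch_cells_Suc_subset:
  "touch_cells (Suc k) \<subseteq> (\<lambda>(c, d). child (base (\<sigma> (Suc k))) c d) `
    (hit_cells k \<times> Omega (\<sigma> (Suc k)) \<union> touch_cells k \<times> touch_digits (\<sigma> (Suc k)))"
proof
  fix x assume x: "x \<in> touch_cells (Suc k)"
  let ?b = "base (\<sigma> (Suc k))"
  from x obtain c d where cd: "x = child ?b c d" "c \<in> cells \<sigma> k" "d \<in> Omega (\<sigma> (Suc k))"
    by (auto simp: touch_cells_def)
  have T: "type_of (Suc k) (child ?b c d) = int (N + M) + 1" "r (Suc k) = 0"
    using x cd(1) by (auto simp: touch_cells_def)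
  have 1: "1 \<le> type_of k c" using type_of_parent_ge[OF cd(3), of c] T by simp
  from type_of_parent_le[OF cd(3), of c] T consider "type_of k c \<le> int (N + M)"
    | "type_of k c = int (N + M) + 1" "\<xi> (Suc k) = 0" "d \<in> touch_digits (\<sigma> (Suc k))"
    using cd(3) by (auto simp: touch_digits_def)
  then show "x \<in> (\<lambda>(c, d). child ?b c d) `
    (hit_cells k \<times> Omega (\<sigma> (Suc k)) \<union> touch_cells k \<times> touch_digits (\<sigma> (Suc k)))"
  proof cases
    case 1
    then have "c \<in> hit_cells k" using \<open>1 \<le> type_of k c\<close> cd by (auto simp: hit_cells_def)
    then show ?thesis using cd by auto
  next
    case 2
    \<comment> \<open>Comparing \<open>D_r\<close> at consecutive levels gives
      \<open>r (Suc k) = b * r k - \<xi> (Suc k)\<close>; digit 0 and a vanishing new remainder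
      force \<open>r k = 0\<close>.\<close>
    have "real ?b * (of_int (D k) + r k) = of_int (D (Suc k)) + r (Suc k)"
      unfolding D_r[symmetric] by simp
    then have "real ?b * r k = 0" using 2(2) T(2) by (simp add: D_Suc algebra_simps)
    then have "c \<in> touch_cells k" using 2 cd by (auto simp: touch_cells_def)
    then show ?thesis using 2 cd by auto
  qed
qed

text \<open>For \<open>M > 0\<close> only the upper left digit can be in
  \<open>touch_digits\<close>, and the number of hit squares does not decrease. For
  \<open>M = 0\<close> a whole row of digits may occur; then a touching square forces
  \<open>r k = 0\<close> and type 1 for all hit squares, so the line runs along their bottom edges
  and each has a full row of hit children.\<close>

lemma card_touch_digits:
  assumes "touch_cells k \<noteq> {}"
  shows "card (touch_digits (\<sigma> (Suc k))) * card (hit_cells k) \<le> card (hit_cells (Suc k))"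
proof -
  let ?s = "\<sigma> (Suc k)"
  let ?b = "int (base ?s)"
  show ?thesis
  proof (cases "M = 0")
    case False
    have "touch_digits ?s \<subseteq> {(0, ?b - 1)}"
    proof
      fix d assume d: "d \<in> touch_digits ?s"
      then have B: "0 \<le> fst d" "snd d \<le> ?b - 1" using Omega_bounds[of d ?s] by (auto simp: touch_digits_def)
      have eq: "fst d * int M = (snd d - (?b - 1)) * int N"
        using d by (simp add: touch_digits_def algebra_simps)
      have "0 \<le> fst d * int M" "(snd d - (?b - 1)) * int N \<le> 0"
        using B by (auto intro: mult_nonpos_nonneg)
      then have "fst d * int M = 0" "(snd d - (?b - 1)) * int N = 0" using eq by auto
      then show "d \<in> {(0, ?b - 1)}" using False N by (simp add: prod_eq_iff)
    qed
    from card_mono[OF _ this] have "card (touch_digits ?s) \<le> 1" by simp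
    then have "card (touch_digits ?s) * card (hit_cells k) \<le> 1 * card (hit_cells k)"
      by (rule mult_right_mono) simp
    also have "\<dots> \<le> card (hit_cells (Suc k))" using card_hit_cells_mono[of k] by simp
    finally show ?thesis .
  next
    case M: True
    have "touch_digits ?s \<subseteq> {0..?b - 1} \<times> {?b - 1}"
    proof
      fix d assume d: "d \<in> touch_digits ?s"
      then have "fst d * int M - snd d * int N = - (?b - 1) * int N" by (simp add: touch_digits_def)
      then have "snd d * int N = (?b - 1) * int N" by (simp add: M algebra_simps)
      then have "snd d = ?b - 1" using N by simp
      then show "d \<in> {0..?b - 1} \<times> {?b - 1}"
        using d Omega_bounds[of d ?s] by (auto simp: touch_digits_def mem_Times_iff)
    qed
    from card_mono[OF _ this] have t: "card (touch_digits ?s) \<le> base ?s"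
      by (simp add: card_cartesian_product)
    from assms obtain c0 where "c0 \<in> touch_cells k" by blast
    then have c0: "type_of k c0 = int N + 1" "r k = 0" unfolding touch_cells_def by (simp_all add: M)
    have "real (base ?s) * (of_int (D k) + r k) = of_int (D (Suc k)) + r (Suc k)"
      unfolding D_r[symmetric] by simp
    then have "real (\<xi> (Suc k)) + r (Suc k) = 0" using c0(2) by (simp add: D_Suc algebra_simps)
    then have \<xi>: "\<xi> (Suc k) = 0" using r_range(1)[of "Suc k"] by linarith
    have "card (touch_digits ?s) \<le> card {d \<in> Omega ?s. child (base ?s) c d \<in> hit_cells (Suc k)}"
      if c: "c \<in> hit_cells k" for c
    proof -
      \<comment> \<open>For \<open>M = 0\<close> types differ by multiples of \<open>N\<close>; as
        \<open>c0\<close> has type \<open>N + 1\<close>, the only such type in \<open>1..N\<close>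
        is 1.\<close>
      have "type_of k c - 1 = type_of k c0 - 1 + (snd c0 - snd c) * int N"
        by (simp add: cell_type_def M algebra_simps)
      then have "type_of k c - 1 = int N * (1 + snd c0 - snd c)"
        unfolding c0(1) by (simp add: algebra_simps)
      moreover have "0 \<le> type_of k c - 1" "type_of k c - 1 < int N" using c unfolding hit_cells_def by (simp_all add: M)
      ultimately have type: "type_of k c = 1"
        by (metis add.commute diff_add_cancel add_0 dvd_triv_left zdvd_not_zless linorder_not_le order_less_le)
      have "(\<lambda>e. (e, 0)) ` {0..?b - 1} \<subseteq> {d \<in> Omega ?s. child (base ?s) c d \<in> hit_cells (Suc k)}"
      proof (intro image_subsetI CollectI conjI)
        fix e assume "e \<in> {0..?b - 1}"
        then show e: "(e, 0) \<in> Omega ?s" by (intro bottom_row_in_Omega) auto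
        have "type_of (Suc k) (child (base ?s) c (e, 0)) = 1"
          unfolding type_of_child type \<xi> by (simp add: M)
        then show "child (base ?s) c (e, 0) \<in> hit_cells (Suc k)"
          using c e N by (auto simp: hit_cells_def)
      qed
      from card_mono[OF _ this]
      have "card ((\<lambda>e. (e, 0 :: int)) ` {0..?b - 1}) \<le>
          card {d \<in> Omega ?s. child (base ?s) c d \<in> hit_cells (Suc k)}"
        by (simp add: finite_Omega)
      moreover have "card ((\<lambda>e. (e, 0 :: int)) ` {0..?b - 1}) = base ?s"
        by (subst card_image) (auto simp: inj_on_def)
      ultimately show ?thesis using t by simp
    qed
    from card_hit_cells_ge[OF this] show ?thesis .
  qed
qed

text \<open>
  Each touching square has at most as many touching children as a hit square has hit children,
  so the new touching squares, at most 12 per hit square and level, only contribute a linear factor.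
\<close>

lemma card_touch_cells_le: "card (touch_cells k) \<le> 12 * k * card (hit_cells k)"
proof (induction k)
  case 0
  have "touch_cells 0 = {}" using \<kappa> by (auto simp: touch_cells_def cell_type_def D_0)
  then show ?case by simp
next
  case (Suc k)
  let ?t = "card (touch_digits (\<sigma> (Suc k)))" and ?h = "card (hit_cells k)"
  have fin: "finite (touch_digits (\<sigma> (Suc k)))" by (simp add: touch_digits_def finite_Omega)
  have "card (touch_cells (Suc k)) \<le>
    card (hit_cells k \<times> Omega (\<sigma> (Suc k)) \<union> touch_cells k \<times> touch_digits (\<sigma> (Suc k)))"
    by (rule surj_card_le[OF _ touch_cells_Suc_subset])
      (simp add: finite_hit_cells finite_touch_cells finite_Omega fin)
  also have "\<dots> \<le> ?h * card (Omega (\<sigma> (Suc k))) + card (touch_cells k) * ?t"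
    unfolding card_cartesian_product[symmetric] by (rule card_Un_le)
  also have "?h * card (Omega (\<sigma> (Suc k))) \<le> 12 * card (hit_cells (Suc k))"
    using mult_mono[OF card_hit_cells_mono[of k] card_Omega_le[of "\<sigma> (Suc k)"]]
    by (simp add: mult.commute)
  also have "card (touch_cells k) * ?t \<le> 12 * k * card (hit_cells (Suc k))"
  proof (cases "touch_cells k = {}")
    case False
    have "card (touch_cells k) * ?t \<le> 12 * k * (?t * ?h)"
      using mult_right_mono[OF Suc, of ?t] by (simp add: algebra_simps)
    also have "\<dots> \<le> 12 * k * card (hit_cells (Suc k))"
      using card_touch_digits[OF False] by (intro mult_left_mono) auto
    finally show ?thesis .
  qed simp
  finally show ?case by (simp add: algebra_simps)
qed

end

subsection \<open>Covering numbers\<close>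

lemma covering_number_le:
  assumes "finite \<C>" "F \<subseteq> \<Union>\<C>" "\<And>U. U \<in> \<C> \<Longrightarrow> bounded U \<and> diameter U \<le> \<delta>"
  shows "covering_number F \<delta> \<le> card \<C>"
  unfolding covering_number_def using assms by (intro Least_le) blast

text \<open>The least size is attained once some finite cover exists; without one,
  \<open>LEAST\<close> carries no information.\<close>

lemma covering_number_witness:
  assumes "finite \<C>" "F \<subseteq> \<Union>\<C>" "\<And>U. U \<in> \<C> \<Longrightarrow> bounded U \<and> diameter U \<le> \<delta>"
  obtains \<D> where "finite \<D>" "card \<D> = covering_number F \<delta>" "F \<subseteq> \<Union>\<D>"
    "\<And>U. U \<in> \<D> \<Longrightarrow> bounded U \<and> diameter U \<le> \<delta>"
proof -
  let ?P = "\<lambda>n. \<exists>\<C>. finite \<C> \<and> card \<C> = n \<and> F \<subseteq> \<Union>\<C> \<and> (\<forall>U\<in>\<C>. bounded U \<and> diameter U \<le> \<delta>)"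
  have "?P (card \<C>)" using assms by blast
  then have "?P (covering_number F \<delta>)" unfolding covering_number_def by (rule LeastI)
  then show ?thesis using that by blast
qed

text \<open>The Euclidean distance is bounded by the sum of the coordinate distances, each at most
  one mesh width, so 2 replaces \<open>sqrt 2\<close>.\<close>

lemma cell_square_bounded_diameter:
  "bounded (cell_square \<sigma> k c) \<and> diameter (cell_square \<sigma> k c) \<le> 2 / real (mesh \<sigma> k)"
proof -
  let ?B = "real (mesh \<sigma> k)"
  have B: "0 < ?B" by simp
  have d: "dist p q \<le> 2 / ?B" if "p \<in> cell_square \<sigma> k c" "q \<in> cell_square \<sigma> k c" for p q
  proof -
    obtain x y x' y' where pq: "p = (x, y)" "q = (x', y')" by (cases p, cases q)
    have "\<bar>?B * x - ?B * x'\<bar> \<le> 1" "\<bar>?B * y - ?B * y'\<bar> \<le> 1"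
      using that unfolding pq cell_square_def by (auto simp: abs_le_iff)
    then have "?B * \<bar>x - x'\<bar> \<le> 1" "?B * \<bar>y - y'\<bar> \<le> 1"
      using B by (simp_all add: right_diff_distrib[symmetric] abs_mult)
    then have "\<bar>x - x'\<bar> \<le> 1 / ?B" "\<bar>y - y'\<bar> \<le> 1 / ?B"
      using B by (simp_all add: field_simps)
    then have "\<bar>x - x'\<bar> + \<bar>y - y'\<bar> \<le> 2 / ?B" by simp
    moreover have "dist p q \<le> \<bar>x - x'\<bar> + \<bar>y - y'\<bar>"
      unfolding pq dist_Pair_Pair dist_real_def
      using sqrt_sum_squares_le_sum_abs[of "x - x'" "y - y'"] by simp
    ultimately show ?thesis by linarith
  qed
  have "bounded (cell_square \<sigma> k c)"
    unfolding bounded_def by (meson d all_not_in_conv)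
  moreover have "diameter (cell_square \<sigma> k c) \<le> 2 / ?B"
    using d B by (intro diameter_le) (auto simp: dist_norm)
  ultimately show ?thesis by simp
qed

text \<open>Such a set meets at most 4 columns and 4 rows of the grid.\<close>

lemma card_cells_meeting_le:
  assumes "bounded U" "diameter U \<le> 1 / real (mesh \<sigma> k)"
    and "\<And>c. c \<in> C \<Longrightarrow> \<exists>p\<in>U. p \<in> cell_square \<sigma> k c"
  shows "finite C \<and> card C \<le> 16"
proof (cases "U = {}")
  case True
  then have "C = {}" using assms(3) by blast
  then show ?thesis by simp
next
  case False
  then obtain x0 y0 where p0: "(x0, y0) \<in> U" by auto
  let ?B = "real (mesh \<sigma> k)"
  have B: "0 < ?B" by simp
  let ?i = "\<lfloor>?B * x0\<rfloor>" and ?j = "\<lfloor>?B * y0\<rfloor>"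
  \<comment> \<open>A corner coordinate \<open>u\<close> with
    \<open>u \<le> B * x \<le> u + 1\<close> and \<open>\<bar>B * x - B * x0\<bar> \<le> 1\<close>
    lies between \<open>B * x0 - 2\<close> and \<open>B * x0 + 1\<close>.\<close>
  have "C \<subseteq> {?i - 2..?i + 1} \<times> {?j - 2..?j + 1}"
  proof
    fix c assume "c \<in> C"
    then obtain x y where p: "(x, y) \<in> U" "(x, y) \<in> cell_square \<sigma> k c" using assms(3) by (metis surj_pair)
    have "dist (x, y) (x0, y0) \<le> 1 / ?B"
      using diameter_bounded_bound[OF assms(1) p(1) p0] assms(2) by linarith
    then have "dist x x0 \<le> 1 / ?B" "dist y y0 \<le> 1 / ?B"
      using dist_fst_le[of "(x, y)" "(x0, y0)"] dist_snd_le[of "(x, y)" "(x0, y0)"] by auto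
    then have "?B * \<bar>x - x0\<bar> \<le> 1" "?B * \<bar>y - y0\<bar> \<le> 1"
      using B by (simp_all add: dist_real_def field_simps)
    then have "\<bar>?B * x - ?B * x0\<bar> \<le> 1" "\<bar>?B * y - ?B * y0\<bar> \<le> 1"
      using B by (simp_all add: right_diff_distrib[symmetric] abs_mult)
    then have "fst c \<in> {?i - 2..?i + 1}" "snd c \<in> {?j - 2..?j + 1}"
      using p(2) unfolding cell_square_def by (auto simp: abs_le_iff) linarith+
    then show "c \<in> {?i - 2..?i + 1} \<times> {?j - 2..?j + 1}" by (simp add: mem_Times_iff)
  qed
  moreover have "card ({?i - 2..?i + 1} \<times> {?j - 2..?j + 1}) = 16"
    by (simp add: card_cartesian_product)
  ultimately show ?thesis
    by (metis card_mono finite_SigmaI finite_atLeastAtMost_int finite_subset)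
qed

section \<open>Comparison of covers of the slice with hit and touching squares\<close>

context carpet_slice
begin

definition slice :: "(real \<times> real) set" where
  "slice = carpet \<sigma> \<inter> {(x, y). y = x * (real M / real N) + a}"

text \<open>This links geometry and types: in coordinates \<open>(s, t)\<close> relative to the
  square, points of the line satisfy \<open>N * t - M * s = h\<close> with the \<open>h\<close>
  explained at \<open>cell_type\<close>.\<close>

lemma slice_offset:
  assumes "y = x * (real M / real N) + a"
  shows "real N * (real (mesh \<sigma> k) * y - of_int (snd c)) - (real (mesh \<sigma> k) * x - of_int (fst c)) * real M =
    of_int (type_of k c) - real M - 1 + r k"
proof -
  have "real N * y = x * real M + real N * a" using N assms by (simp add: field_simps)
  then have "real (mesh \<sigma> k) * (real N * y) = real (mesh \<sigma> k) * (x * real M + real N * a)" by simp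
  then show ?thesis using D_r[of k] by (simp add: cell_type_def algebra_simps)
qed

lemma hit_cell_meets_slice:
  assumes c: "c \<in> hit_cells k"
  shows "\<exists>p\<in>slice. p \<in> cell_square \<sigma> k c"
proof -
  let ?B = "real (mesh \<sigma> k)"
  have B: "0 < ?B" by simp
  define h where "h = of_int (type_of k c) - real M - 1 + r k"
  have ck: "c \<in> cells \<sigma> k" and type: "1 \<le> type_of k c" "type_of k c \<le> int N + int M"
    using c by (auto simp: hit_cells_def)
  have h: "- real M \<le> h" "h \<le> real N"
    using type r_range(1)[of k] r_range(2)[of k] unfolding h_def by linarith+
  \<comment> \<open>For \<open>h \<ge> 0\<close> the line enters through the left edge at height
    \<open>h / N\<close>; otherwise through the bottom edge at distance \<open>- h / M\<close> from
    the corner, where \<open>h \<ge> - M\<close> forces \<open>M > 0\<close>.\<close>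
  show ?thesis
  proof (cases "0 \<le> h")
    case True
    define x where "x = of_int (fst c) / ?B"
    define y where "y = x * (real M / real N) + a"
    have x: "?B * x = of_int (fst c)" by (simp add: x_def)
    have "real N * (?B * y - of_int (snd c)) = h"
      using slice_offset[OF y_def, of k c] x by (simp add: h_def)
    then have "?B * y - of_int (snd c) = h / real N" using N by (simp add: field_simps)
    moreover have "0 \<le> h / real N" "h / real N \<le> 1" using True h N by auto
    ultimately have sq: "(x, y) \<in> cell_square \<sigma> k c" using x by (auto simp: cell_square_def)
    then have "on_left_edge \<sigma> k (x, y)" using ck x by (auto simp: on_left_edge_def)
    then have "(x, y) \<in> slice" using edge_subset_carpet by (auto simp: slice_def y_def)
    then show ?thesis using sq by blast
  next
    case False
    then have M: "0 < real M" using h by linarith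
    define x where "x = (of_int (fst c) - h / real M) / ?B"
    define y where "y = x * (real M / real N) + a"
    have x: "?B * x - of_int (fst c) = - (h / real M)" by (simp add: x_def)
    have "real N * (?B * y - of_int (snd c)) = 0"
      using slice_offset[OF y_def, of k c] x M by (simp add: h_def[symmetric])
    then have y: "?B * y = of_int (snd c)" using N by simp
    moreover have "0 \<le> - (h / real M)" "- (h / real M) \<le> 1" using False h M by (auto simp: field_simps)
    ultimately have sq: "(x, y) \<in> cell_square \<sigma> k c" using x by (auto simp: cell_square_def)
    then have "on_bottom_edge \<sigma> k (x, y)" using ck y by (auto simp: on_bottom_edge_def)
    then have "(x, y) \<in> slice" using edge_subset_carpet by (auto simp: slice_def y_def)
    then show ?thesis using sq by blast
  qed
qed

lemma slice_subset: "slice \<subseteq> (\<Union>c\<in>hit_cells k \<union> touch_cells k. cell_square \<sigma> k c)"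
proof
  fix p assume p: "p \<in> slice"
  then obtain x y where xy: "p = (x, y)" "y = x * (real M / real N) + a" by (auto simp: slice_def)
  let ?B = "real (mesh \<sigma> k)"
  obtain c where c: "c \<in> cells \<sigma> k" "(x, y) \<in> cell_square \<sigma> k c"
    using p carpet_subset_level[of \<sigma> k] by (auto simp: slice_def carpet_level_eq xy(1))
  define s where "s = ?B * x - of_int (fst c)"
  define t where "t = ?B * y - of_int (snd c)"
  have st: "0 \<le> s" "s \<le> 1" "0 \<le> t" "t \<le> 1" using c(2) by (auto simp: cell_square_def s_def t_def)
  have off: "real N * t - s * real M = of_int (type_of k c) - real M - 1 + r k"
    using slice_offset[OF xy(2), of k c] by (simp add: s_def t_def)
  have bounds: "0 \<le> real N * t" "real N * t \<le> real N" "0 \<le> s * real M" "s * real M \<le> real M"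
    using st by (auto simp: mult_left_le mult_left_le_one_le)
  have upper: "type_of k c \<le> int (N + M) + 1"
    using off bounds r_range(1)[of k] by linarith
  have upper_eq: "r k = 0" if "type_of k c = int (N + M) + 1"
    using off bounds r_range(1)[of k] that by simp
  \<comment> \<open>The inequalities alone exclude type 0 only if \<open>r k < 1\<close>. For
    \<open>a = 1\<close> the remainder may be 1, but then \<open>0 \<le> x\<close> and
    \<open>y \<le> 1\<close> leave only \<open>y = 1\<close>, so the point is on the top edge of its
    square.\<close>
  have lower: "1 \<le> type_of k c"
  proof (cases "a < 1")
    case True
    then show ?thesis using off bounds r_less_1[of k] by linarith
  next
    case False
    then have a: "a = 1" using a_le_1 by simp
    have "0 \<le> ?B * x" "?B * y \<le> ?B"
    proof -
      have "0 \<le> real_of_int (fst c)" "real_of_int (snd c) + 1 \<le> ?B"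
        using cells_bounds[OF c(1)] by (simp, linarith)
      then show "0 \<le> ?B * x" "?B * y \<le> ?B" using st unfolding s_def t_def by linarith+
    qed
    then have "0 \<le> x" "y \<le> 1" by (simp_all add: zero_le_mult_iff less_le)
    moreover have "0 \<le> x * (real M / real N)" using \<open>0 \<le> x\<close> by simp
    ultimately have "y = 1" using xy(2) a by linarith
    then have "t = ?B - of_int (snd c)" by (simp add: t_def)
    moreover have "1 \<le> ?B - real_of_int (snd c)" using cells_bounds(4)[OF c(1)] by linarith
    ultimately have "real N * 1 \<le> real N * t" by (intro mult_left_mono) auto
    then have "real N - real M \<le> of_int (type_of k c) - real M"
      using off bounds r_range(2)[of k] by linarith
    then show ?thesis using N by linarith
  qed
  have "c \<in> hit_cells k \<union> touch_cells k"
    using c(1) lower upper upper_eq by (auto simp: hit_cells_def touch_cells_def)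
  then show "p \<in> (\<Union>c\<in>hit_cells k \<union> touch_cells k. cell_square \<sigma> k c)" using c(2) xy(1) by blast
qed

lemma covering_number_slice_le:
  assumes "2 / real (mesh \<sigma> k) \<le> \<delta>"
  shows "covering_number slice \<delta> \<le> (12 * k + 1) * card (hit_cells k)"
proof -
  let ?\<C> = "cell_square \<sigma> k ` (hit_cells k \<union> touch_cells k)"
  have "covering_number slice \<delta> \<le> card ?\<C>"
  proof (rule covering_number_le)
    show "finite ?\<C>" by (simp add: finite_hit_cells finite_touch_cells)
    show "slice \<subseteq> \<Union>?\<C>" using slice_subset[of k] by simp
    show "bounded U \<and> diameter U \<le> \<delta>" if "U \<in> ?\<C>" for U
      using that cell_square_bounded_diameter[of \<sigma> k] assms by (blast intro: order_trans)
  qed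
  also have "\<dots> \<le> card (hit_cells k \<union> touch_cells k)"
    by (intro card_image_le) (simp add: finite_hit_cells finite_touch_cells)
  also have "\<dots> \<le> card (hit_cells k) + card (touch_cells k)" by (rule card_Un_le)
  also have "\<dots> \<le> (12 * k + 1) * card (hit_cells k)"
    using card_touch_cells_le[of k] by simp
  finally show ?thesis .
qed

text \<open>Each hit square contains a point of the slice, which lies in some set of an optimal
  cover, and one set serves at most 16 squares.\<close>

lemma card_hit_cells_le_covering_number:
  assumes "0 < \<delta>" "\<delta> \<le> 1 / real (mesh \<sigma> k)"
  shows "card (hit_cells k) \<le> 16 * covering_number slice \<delta>"
proof -
  \<comment> \<open>Level \<open>j\<close> serves to exhibit some finite cover by sets of diameter
    at most \<open>\<delta>\<close>, so that an optimal one exists.\<close>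
  obtain j where j: "2 / \<delta> < 3 ^ j"
    using real_arch_pow[of 3 "2 / \<delta>"] by auto
  have "3 ^ j \<le> real (mesh \<sigma> j)"
    using mesh_ge_power[of j \<sigma>] by (metis of_nat_le_iff of_nat_numeral of_nat_power)
  then have "2 / \<delta> \<le> real (mesh \<sigma> j)" using j by linarith
  then have fine: "2 / real (mesh \<sigma> j) \<le> \<delta>" using assms(1) by (simp add: field_simps)
  obtain \<D> where \<D>: "finite \<D>" "card \<D> = covering_number slice \<delta>" "slice \<subseteq> \<Union>\<D>"
    "\<And>U. U \<in> \<D> \<Longrightarrow> bounded U \<and> diameter U \<le> \<delta>"
  proof (rule covering_number_witness)
    let ?\<C> = "cell_square \<sigma> j ` (hit_cells j \<union> touch_cells j)"
    show "finite ?\<C>" by (simp add: finite_hit_cells finite_touch_cells)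
    show "slice \<subseteq> \<Union>?\<C>" using slice_subset[of j] by auto
    show "bounded U \<and> diameter U \<le> \<delta>" if "U \<in> ?\<C>" for U
      using that cell_square_bounded_diameter[of \<sigma> j] fine by (blast intro: order_trans)
  qed auto
  let ?C = "\<lambda>U. {c \<in> hit_cells k. \<exists>p\<in>U. p \<in> cell_square \<sigma> k c}"
  have "hit_cells k \<subseteq> (\<Union>U\<in>\<D>. ?C U)"
    using hit_cell_meets_slice[of _ k] \<D>(3) by fastforce
  then have "card (hit_cells k) \<le> card (\<Union>U\<in>\<D>. ?C U)"
    by (intro card_mono) (simp_all add: \<D>(1) finite_hit_cells)
  also have "\<dots> \<le> (\<Sum>U\<in>\<D>. card (?C U))" using \<D>(1) by (rule card_UN_le)
  also have "\<dots> \<le> (\<Sum>U\<in>\<D>. 16)"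
  proof (rule sum_mono)
    fix U assume "U \<in> \<D>"
    then have "bounded U" "diameter U \<le> 1 / real (mesh \<sigma> k)" using \<D>(4)[of U] assms(2) by auto
    then have "finite (?C U) \<and> card (?C U) \<le> 16" by (rule card_cells_meeting_le) auto
    then show "card (?C U) \<le> 16" by simp
  qed
  finally show ?thesis using \<D>(2) by (simp add: mult.commute)
qed

end

subsection \<open>From scales to levels\<close>

lemma Limsup_filterlim_le:
  fixes g :: "'b \<Rightarrow> 'c :: complete_linorder"
  assumes "filterlim l G F"
  shows "Limsup F (\<lambda>x. g (l x)) \<le> Limsup G g"
  unfolding Limsup_le_iff
proof (intro allI impI)
  fix y assume "Limsup G g < y"
  then have "eventually (\<lambda>x. g x < y) G" by (rule Limsup_lessD)
  then show "eventually (\<lambda>x. g (l x) < y) F" by (rule eventually_compose_filterlim[OF _ assms])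
qed

lemma Liminf_filterlim_ge:
  fixes g :: "'b \<Rightarrow> 'c :: complete_linorder"
  assumes "filterlim l G F"
  shows "Liminf G g \<le> Liminf F (\<lambda>x. g (l x))"
  unfolding le_Liminf_iff
proof (intro allI impI)
  fix y assume "y < Liminf G g"
  then have "eventually (\<lambda>x. y < g x) G" by (rule less_LiminfD)
  then show "eventually (\<lambda>x. y < g (l x)) F" by (rule eventually_compose_filterlim[OF _ assms])
qed

text \<open>The limits along \<open>F\<close> and \<open>G\<close> bound each other:
  \<open>l\<close> carries \<open>F\<close> to \<open>G\<close>, and \<open>s\<close> carries
  \<open>G\<close> back to \<open>F\<close> with \<open>g (l (s x)) = g x\<close>.\<close>

lemma Limsup_Liminf_compose:
  fixes g :: "'b \<Rightarrow> 'c :: complete_linorder"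
  assumes "filterlim l G F" "filterlim s F G" "\<And>x. l (s x) = x"
  shows "Limsup F (\<lambda>x. g (l x)) = Limsup G g" "Liminf F (\<lambda>x. g (l x)) = Liminf G g"
  using Limsup_filterlim_le[OF assms(1), of g] Limsup_filterlim_le[OF assms(2), of "\<lambda>x. g (l x)"]
    Liminf_filterlim_ge[OF assms(1), of g] Liminf_filterlim_ge[OF assms(2), of "\<lambda>x. g (l x)"]
  by (simp_all add: assms(3))

lemma Limsup_Liminf_cong_tendsto:
  fixes f g :: "'a \<Rightarrow> real"
  assumes "F \<noteq> bot" "((\<lambda>x. f x - g x) \<longlongrightarrow> 0) F"
  shows "Limsup F (\<lambda>x. ereal (f x)) = Limsup F (\<lambda>x. ereal (g x))"
    "Liminf F (\<lambda>x. ereal (f x)) = Liminf F (\<lambda>x. ereal (g x))"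
proof -
  \<comment> \<open>Stated for arbitrary \<open>f\<close> and \<open>g\<close>, so that it can be
    used again with their roles exchanged.\<close>
  have le: "Limsup F (\<lambda>x. ereal (f x)) \<le> Limsup F (\<lambda>x. ereal (g x))"
      "Liminf F (\<lambda>x. ereal (f x)) \<le> Liminf F (\<lambda>x. ereal (g x))"
    if lim: "((\<lambda>x. f x - g x) \<longlongrightarrow> 0) F" for f g :: "'a \<Rightarrow> real"
  proof -
    have ev: "eventually (\<lambda>x. ereal (f x) \<le> ereal (g x) + ereal e) F" if "0 < e" for e
      using order_tendstoD(2)[OF lim that] by (rule eventually_mono) simp
    show "Limsup F (\<lambda>x. ereal (f x)) \<le> Limsup F (\<lambda>x. ereal (g x))"
    proof (rule ereal_le_epsilon2)
      fix e :: real assume "0 < e"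
      then have "Limsup F (\<lambda>x. ereal (f x)) \<le> Limsup F (\<lambda>x. ereal (g x) + ereal e)"
        by (intro Limsup_mono ev)
      also have "\<dots> = Limsup F (\<lambda>x. ereal (g x)) + ereal e"
        using assms(1) by (rule Limsup_add_ereal_right) simp
      finally show "Limsup F (\<lambda>x. ereal (f x)) \<le> Limsup F (\<lambda>x. ereal (g x)) + ereal e" .
    qed
    show "Liminf F (\<lambda>x. ereal (f x)) \<le> Liminf F (\<lambda>x. ereal (g x))"
    proof (rule ereal_le_epsilon2)
      fix e :: real assume "0 < e"
      then have "Liminf F (\<lambda>x. ereal (f x)) \<le> Liminf F (\<lambda>x. ereal (g x) + ereal e)"
        by (intro Liminf_mono ev)
      also have "\<dots> = Liminf F (\<lambda>x. ereal (g x)) + ereal e"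
        using assms(1) by (rule Liminf_add_ereal_right) simp
      finally show "Liminf F (\<lambda>x. ereal (f x)) \<le> Liminf F (\<lambda>x. ereal (g x)) + ereal e" .
    qed
  qed
  have "((\<lambda>x. g x - f x) \<longlongrightarrow> 0) F" using tendsto_minus[OF assms(2)] by simp
  note rev = le[OF this]
  show "Limsup F (\<lambda>x. ereal (f x)) = Limsup F (\<lambda>x. ereal (g x))"
    using le(1)[OF assms(2)] rev(1) by (rule antisym)
  show "Liminf F (\<lambda>x. ereal (f x)) = Liminf F (\<lambda>x. ereal (g x))"
    using le(2)[OF assms(2)] rev(2) by (rule antisym)
qed

text \<open>For \<open>0 < \<delta> \<le> 1\<close> this is the \<open>k\<close> with
  \<open>mesh \<sigma> k \<le> 1 / \<delta> < mesh \<sigma> (Suc k)\<close>. The strict inequality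
  makes \<open>1 / mesh \<sigma> k\<close> have level exactly \<open>k\<close>.\<close>

definition level :: "(nat \<Rightarrow> nat) \<Rightarrow> real \<Rightarrow> nat" where
  "level \<sigma> \<delta> = (LEAST k. 1 / \<delta> < real (mesh \<sigma> (Suc k)))"

lemma mesh_strict_mono: "strict_mono (mesh \<sigma>)"
proof (rule strict_monoI_Suc)
  fix k
  have "1 * mesh \<sigma> k < base (\<sigma> (Suc k)) * mesh \<sigma> k"
    using base_ge_3[of "\<sigma> (Suc k)"] mesh_pos[of \<sigma> k] by (intro mult_strict_right_mono) linarith+
  then show "mesh \<sigma> k < mesh \<sigma> (Suc k)" by simp
qed

lemma mesh_at_top: "filterlim (\<lambda>k. real (mesh \<sigma> k)) at_top sequentially"
  by (intro filterlim_compose[OF filterlim_real_sequentially] filterlim_subseq mesh_strict_mono)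

lemma level_upper: "1 / \<delta> < real (mesh \<sigma> (Suc (level \<sigma> \<delta>)))"
proof -
  have "eventually (\<lambda>k. 1 / \<delta> < real (mesh \<sigma> k)) sequentially"
    using mesh_at_top[of \<sigma>] by (simp add: filterlim_at_top_dense)
  then have "eventually (\<lambda>k. 1 / \<delta> < real (mesh \<sigma> (Suc k))) sequentially"
    by (subst eventually_sequentially_Suc)
  then obtain k where "1 / \<delta> < real (mesh \<sigma> (Suc k))"
    using eventually_happens'[OF sequentially_bot] by blast
  then show ?thesis unfolding level_def by (rule LeastI)
qed

lemma level_lower:
  assumes "0 < \<delta>" "\<delta> \<le> 1"
  shows "real (mesh \<sigma> (level \<sigma> \<delta>)) \<le> 1 / \<delta>"
proof (cases "level \<sigma> \<delta>")
  case 0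
  then show ?thesis using assms by simp
next
  case (Suc j)
  then have "j < level \<sigma> \<delta>" by simp
  then have "\<not> 1 / \<delta> < real (mesh \<sigma> (Suc j))" unfolding level_def by (rule not_less_Least)
  then show ?thesis using Suc by simp
qed

lemma level_inverse_mesh: "level \<sigma> (1 / real (mesh \<sigma> k)) = k"
  unfolding level_def
  by (rule Least_equality) (simp_all add: strict_mono_less[OF mesh_strict_mono] del: mesh.simps)

lemma filterlim_level: "filterlim (level \<sigma>) sequentially (at_right 0)"
  unfolding filterlim_at_top
proof
  fix K
  have "eventually (\<lambda>\<delta>. \<delta> < 1 / real (mesh \<sigma> K)) (at_right 0)"
    by (rule order_tendstoD(2)[OF tendsto_ident_at]) simp
  then show "eventually (\<lambda>\<delta>. K \<le> level \<sigma> \<delta>) (at_right 0)"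
    using eventually_at_right_less[of 0]
  proof eventually_elim
    case (elim \<delta>)
    then have "real (mesh \<sigma> K) < 1 / \<delta>" by (simp add: field_simps)
    then have "real (mesh \<sigma> K) < real (mesh \<sigma> (Suc (level \<sigma> \<delta>)))" using level_upper[of \<delta> \<sigma>] by linarith
    then have "K < Suc (level \<sigma> \<delta>)"
      using strict_mono_less[OF mesh_strict_mono[of \<sigma>]] by (simp del: mesh.simps)
    then show ?case by simp
  qed
qed

lemma filterlim_inverse_mesh: "filterlim (\<lambda>k. 1 / real (mesh \<sigma> k)) (at_right 0) sequentially"
  using filterlim_compose[OF filterlim_inverse_at_right_top mesh_at_top]
  by (simp add: inverse_eq_divide)

text \<open>Over a common denominator the difference is
  \<open>(e * b - s * f) / (b * (b + f))\<close>; the bound \<open>s \<le> 3 * b\<close> lets one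
  factor \<open>b\<close> cancel.\<close>

lemma abs_perturbed_quotient_le:
  fixes s e b f E :: real
  assumes "0 < b" "0 \<le> f" "0 \<le> s" "s \<le> 3 * b" "\<bar>e\<bar> \<le> E"
  shows "\<bar>(s + e) / (b + f) - s / b\<bar> \<le> (E + 3 * f) / b"
proof -
  have "(s + e) / (b + f) - s / b = ((s + e) * b - s * (b + f)) / ((b + f) * b)"
    using assms by (intro diff_frac_eq) auto
  also have "\<dots> = (e * b - s * f) / (b * (b + f))"
    by (simp add: distrib_left distrib_right mult.commute)
  finally have "\<bar>(s + e) / (b + f) - s / b\<bar> = \<bar>e * b - s * f\<bar> / (b * (b + f))"
    using assms by (simp add: abs_divide abs_mult)
  also have "\<dots> \<le> (b * (E + 3 * f)) / (b * b)"
  proof (rule frac_le)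
    have "\<bar>e * b - s * f\<bar> \<le> \<bar>e\<bar> * b + s * f"
      using assms abs_triangle_ineq4[of "e * b" "s * f"] by (simp add: abs_mult)
    also have "\<dots> \<le> E * b + 3 * b * f"
      using assms by (intro add_mono mult_right_mono) auto
    finally show "\<bar>e * b - s * f\<bar> \<le> b * (E + 3 * f)" by (simp add: algebra_simps)
    then show "0 \<le> b * (E + 3 * f)" by linarith
  qed (use assms in \<open>auto intro: mult_left_mono\<close>)
  finally show ?thesis using assms by simp
qed

section \<open>Error between the covering ratio at a scale and the counting ratio at its
  level\<close>

context carpet_slice
begin

lemma card_hit_cells_le_power: "card (hit_cells k) \<le> 12 ^ k"
proof -
  have "card (hit_cells k) \<le> card (cells \<sigma> k)"
    by (rule card_mono) (auto simp: finite_cells hit_cells_def)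
  then show ?thesis using card_cells_le[of \<sigma> k] by linarith
qed

lemma covering_number_level_bounds:
  assumes "0 < \<delta>" "\<delta> \<le> 1"
  shows "card (hit_cells (level \<sigma> \<delta>)) \<le> 16 * covering_number slice \<delta>"
    and "covering_number slice \<delta> \<le> 144 * (12 * level \<sigma> \<delta> + 25) * card (hit_cells (level \<sigma> \<delta>))"
proof -
  let ?k = "level \<sigma> \<delta>"
  let ?B = "\<lambda>k. real (mesh \<sigma> k)"
  have "\<delta> \<le> 1 / ?B ?k"
    using level_lower[OF assms, of \<sigma>] assms(1) by (simp add: field_simps)
  then show "card (hit_cells ?k) \<le> 16 * covering_number slice \<delta>"
    by (rule card_hit_cells_le_covering_number[OF assms(1)])
  \<comment> \<open>Squares of diameter at most \<open>2 / mesh\<close> have to fit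
    \<open>\<delta>\<close>, for which two levels beyond \<open>level \<sigma> \<delta>\<close> are
    enough. They cost the factor \<open>12 * 12 = 144\<close>, and
    \<open>12 * (k + 2) + 1 = 12 * k + 25\<close>.\<close>
  have "2 * ?B (Suc ?k) \<le> real (base (\<sigma> (Suc (Suc ?k)))) * ?B (Suc ?k)"
    using base_ge_3[of "\<sigma> (Suc (Suc ?k))"] by (intro mult_right_mono) auto
  then have "2 * ?B (Suc ?k) \<le> ?B (Suc (Suc ?k))" by simp
  moreover have "2 / \<delta> = 2 * (1 / \<delta>)" by simp
  ultimately have "2 / \<delta> \<le> ?B (Suc (Suc ?k))"
    using level_upper[of \<delta> \<sigma>] by linarith
  then have "2 / ?B (Suc (Suc ?k)) \<le> \<delta>"
    using assms(1) by (simp add: field_simps del: mesh.simps)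
  then have "covering_number slice \<delta> \<le> (12 * Suc (Suc ?k) + 1) * card (hit_cells (Suc (Suc ?k)))"
    by (rule covering_number_slice_le)
  also have "\<dots> \<le> (12 * ?k + 25) * (144 * card (hit_cells ?k))"
    using card_hit_cells_le[of "?k"] card_hit_cells_le[of "Suc ?k"]
    by (intro mult_mono) auto
  finally show "covering_number slice \<delta> \<le> 144 * (12 * ?k + 25) * card (hit_cells ?k)"
    by (simp add: algebra_simps)
qed

lemma ln_mesh_ge: "real k * ln 3 \<le> ln (real (mesh \<sigma> k))"
proof -
  have "real (3 ^ k) \<le> real (mesh \<sigma> k)" using mesh_ge_power[of k \<sigma>] of_nat_le_iff by blast
  then have "ln (3 ^ k) \<le> ln (real (mesh \<sigma> k))" by (intro ln_mono) auto
  then show ?thesis by (simp add: ln_realpow)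
qed

definition level_ratio :: "nat \<Rightarrow> real" where
  "level_ratio k = ln (real (card (hit_cells k))) / ln (real (mesh \<sigma> k))"

text \<open>\<open>abs_perturbed_quotient_le\<close> is applied to logarithms: replacing the count
  by the covering number changes the numerator by at most the logarithm of the linear factor, and
  replacing \<open>mesh\<close> by \<open>1 / \<delta>\<close> increases the denominator by at most
  \<open>ln 4\<close>.\<close>

lemma covering_ratio_close:
  assumes "0 < \<delta>" "\<delta> \<le> 1" "1 \<le> level \<sigma> \<delta>"
  defines "k \<equiv> real (level \<sigma> \<delta>)"
  shows "\<bar>ln (real (covering_number slice \<delta>)) / - ln \<delta> - level_ratio (level \<sigma> \<delta>)\<bar>
    \<le> (ln (144 * (12 * k + 25)) + 3 * ln 4) / (k * ln 3)"
proof -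
  define S where "S = real (card (hit_cells (level \<sigma> \<delta>)))"
  define C where "C = real (covering_number slice \<delta>)"
  define B where "B = real (mesh \<sigma> (level \<sigma> \<delta>))"
  have k: "1 \<le> k" using assms(3) by (simp add: k_def)
  have S: "1 \<le> S" using card_hit_cells_pos[of "level \<sigma> \<delta>"] by (simp add: S_def)
  have SC: "S \<le> 16 * C" using covering_number_level_bounds(1)[OF assms(1,2)]
    unfolding S_def C_def by linarith
  have CS: "C \<le> 144 * (12 * k + 25) * S"
  proof -
    have "C \<le> real (144 * (12 * level \<sigma> \<delta> + 25) * card (hit_cells (level \<sigma> \<delta>)))"
      unfolding C_def using covering_number_level_bounds(2)[OF assms(1,2)] of_nat_le_iff by blast
    then show ?thesis by (simp add: S_def k_def)
  qed
  have C: "0 < C" using S SC by linarith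
  have B: "1 \<le> B" using mesh_pos[of \<sigma> "level \<sigma> \<delta>"] unfolding B_def by linarith
  have lnB: "k * ln 3 \<le> ln B" using ln_mesh_ge[of "level \<sigma> \<delta>"] by (simp add: B_def k_def)
  have lnB_pos: "0 < k * ln 3" using k by simp
  have e: "\<bar>ln C - ln S\<bar> \<le> ln (144 * (12 * k + 25))"
  proof -
    have "ln C \<le> ln (144 * (12 * k + 25) * S)" using C CS k S by (subst ln_le_cancel_iff) auto
    also have "\<dots> = ln (144 * (12 * k + 25)) + ln S" using k S by (intro ln_mult_pos) auto
    finally have 1: "ln C - ln S \<le> ln (144 * (12 * k + 25))" by simp
    have "ln S \<le> ln (16 * C)" using SC S C by (subst ln_le_cancel_iff) auto
    also have "\<dots> = ln 16 + ln C" using C by (intro ln_mult_pos) auto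
    also have "ln 16 \<le> ln (144 * (12 * k + 25))" using k by (subst ln_le_cancel_iff) auto
    finally have "ln S - ln C \<le> ln (144 * (12 * k + 25))" by simp
    with 1 show ?thesis by linarith
  qed
  have low: "B \<le> 1 / \<delta>" using level_lower[OF assms(1,2), of \<sigma>] by (simp add: B_def)
  have "1 / \<delta> \<le> 4 * B"
  proof -
    have "real (base (\<sigma> (Suc (level \<sigma> \<delta>)))) * B \<le> 4 * B"
      using base_le_4[of "\<sigma> (Suc (level \<sigma> \<delta>))"] B by (intro mult_right_mono) auto
    moreover have "1 / \<delta> < real (base (\<sigma> (Suc (level \<sigma> \<delta>)))) * B"
      using level_upper[of \<delta> \<sigma>] by (simp add: B_def)
    ultimately show ?thesis by linarith
  qed
  then have "ln (1 / \<delta>) \<le> ln (4 * B)" using assms(1) B by (subst ln_le_cancel_iff) auto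
  also have "\<dots> = ln 4 + ln B" using B by (intro ln_mult_pos) auto
  finally have f_le: "- ln \<delta> - ln B \<le> ln 4" using assms(1) by (simp add: ln_div)
  have "ln B \<le> ln (1 / \<delta>)" using low B assms(1) by (subst ln_le_cancel_iff) auto
  then have f_ge: "0 \<le> - ln \<delta> - ln B" using assms(1) by (simp add: ln_div)
  \<comment> \<open>The constant 3 comes from \<open>12 \<le> 3 ^ 3\<close>: at most
    \<open>12 ^ k\<close> squares against a mesh of at least \<open>3 ^ k\<close>.\<close>
  have "ln S \<le> 3 * ln B"
  proof -
    have "S \<le> real (12 ^ level \<sigma> \<delta>)"
      unfolding S_def using card_hit_cells_le_power of_nat_le_iff by blast
    then have "ln S \<le> ln (12 ^ level \<sigma> \<delta>)" using S by (subst ln_le_cancel_iff) auto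
    also have "\<dots> = k * ln 12" by (simp add: ln_realpow k_def)
    also have "\<dots> \<le> k * (3 * ln 3)"
    proof (intro mult_left_mono)
      have "ln (12::real) \<le> ln (3 ^ 3)" by (subst ln_le_cancel_iff) auto
      also have "\<dots> = 3 * ln 3" by (subst ln_realpow) auto
      finally show "ln (12::real) \<le> 3 * ln 3" .
    qed (use k in auto)
    also have "\<dots> \<le> 3 * ln B" using lnB by simp
    finally show ?thesis .
  qed
  then have "\<bar>(ln S + (ln C - ln S)) / (ln B + (- ln \<delta> - ln B)) - ln S / ln B\<bar>
    \<le> (ln (144 * (12 * k + 25)) + 3 * (- ln \<delta> - ln B)) / ln B"
    using lnB lnB_pos f_ge S e by (intro abs_perturbed_quotient_le) auto
  also have "\<dots> \<le> (ln (144 * (12 * k + 25)) + 3 * ln 4) / (k * ln 3)"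
    using f_le f_ge lnB lnB_pos k by (intro frac_le add_mono) (auto intro!: add_nonneg_nonneg)
  finally show ?thesis by (simp add: level_ratio_def S_def C_def B_def)
qed

lemma covering_ratio_tendsto:
  "((\<lambda>\<delta>. ln (real (covering_number slice \<delta>)) / - ln \<delta> - level_ratio (level \<sigma> \<delta>)) \<longlongrightarrow> 0) (at_right 0)"
proof (rule Lim_null_comparison)
  let ?h = "\<lambda>k. (ln (144 * (12 * real k + 25)) + 3 * ln 4) / (real k * ln 3)"
  \<comment> \<open>The error is of order \<open>ln k / k\<close>, so the factor linear in
    \<open>k\<close> disappears in the limit.\<close>
  have "?h \<longlonglongrightarrow> 0" by real_asymp
  then show "((\<lambda>\<delta>. ?h (level \<sigma> \<delta>)) \<longlongrightarrow> 0) (at_right 0)"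
    by (rule filterlim_compose[OF _ filterlim_level])
  have "eventually (\<lambda>\<delta>::real. \<delta> < 1) (at_right 0)"
    by (rule order_tendstoD(2)[OF tendsto_ident_at]) simp
  moreover have "eventually (\<lambda>\<delta>. 1 \<le> level \<sigma> \<delta>) (at_right 0)"
    using filterlim_level[of \<sigma>] by (simp add: filterlim_at_top)
  ultimately show "eventually (\<lambda>\<delta>. norm (ln (real (covering_number slice \<delta>)) / - ln \<delta> -
      level_ratio (level \<sigma> \<delta>)) \<le> ?h (level \<sigma> \<delta>)) (at_right 0)"
    using eventually_at_right_less[of 0]
    by eventually_elim (simp only: real_norm_def, rule covering_ratio_close, auto)
qed

lemma box_dim_slice:
  "upper_box_dim slice = limsup (\<lambda>k. ereal (level_ratio k))"
  "lower_box_dim slice = liminf (\<lambda>k. ereal (level_ratio k))"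
proof -
  note cong = Limsup_Liminf_cong_tendsto[OF trivial_limit_at_right_real covering_ratio_tendsto]
  note compose = Limsup_Liminf_compose[OF filterlim_level[of \<sigma>] filterlim_inverse_mesh[of \<sigma>]
    level_inverse_mesh, of "\<lambda>k. ereal (level_ratio k)"]
  show "upper_box_dim slice = limsup (\<lambda>k. ereal (level_ratio k))"
    unfolding upper_box_dim_def cong compose ..
  show "lower_box_dim slice = liminf (\<lambda>k. ereal (level_ratio k))"
    unfolding lower_box_dim_def cong compose ..
qed

end

subsection \<open>The greedy digits\<close>

text \<open>For \<open>t\<close> in the unit interval the cap at \<open>base - 1\<close> takes
  effect only at remainder 1, which then reproduces itself; this happens only for
  \<open>t = 1\<close>.\<close>

primrec greedy_rem :: "(nat \<Rightarrow> nat) \<Rightarrow> real \<Rightarrow> nat \<Rightarrow> real" where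
  "greedy_rem \<sigma> t 0 = t"
| "greedy_rem \<sigma> t (Suc k) = real (base (\<sigma> (Suc k))) * greedy_rem \<sigma> t k -
     of_int (min \<lfloor>real (base (\<sigma> (Suc k))) * greedy_rem \<sigma> t k\<rfloor> (int (base (\<sigma> (Suc k))) - 1))"

definition greedy_digit :: "(nat \<Rightarrow> nat) \<Rightarrow> real \<Rightarrow> nat \<Rightarrow> nat" where
  "greedy_digit \<sigma> t i =
     nat (min \<lfloor>real (base (\<sigma> i)) * greedy_rem \<sigma> t (i - 1)\<rfloor> (int (base (\<sigma> i)) - 1))"

lemma greedy_step_range:
  fixes x :: real
  assumes "0 \<le> x" "x \<le> 1" "0 < b"
  defines "e \<equiv> min \<lfloor>real b * x\<rfloor> (int b - 1)"
  shows "0 \<le> e" "e < int b" "0 \<le> real b * x - of_int e" "real b * x - of_int e \<le> 1"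
    "x < 1 \<Longrightarrow> real b * x - of_int e < 1"
proof -
  have x: "0 \<le> real b * x" "real b * x \<le> real b"
    using assms mult_left_mono[of x 1 "real b"] by auto
  show "0 \<le> e" "e < int b" using x assms(3) by (auto simp: e_def)
  have "e \<le> \<lfloor>real b * x\<rfloor>" by (simp add: e_def)
  then show "0 \<le> real b * x - of_int e" by linarith
  have cases: "e = \<lfloor>real b * x\<rfloor> \<or> e = int b - 1" by (auto simp: e_def)
  then show "real b * x - of_int e \<le> 1" using x by auto linarith
  show "real b * x - of_int e < 1" if "x < 1"
  proof -
    have "real b * x < real b * 1" using that assms(3) by (intro mult_strict_left_mono) auto
    then show ?thesis using cases by auto linarith
  qed
qed

context
  fixes \<sigma> :: "nat \<Rightarrow> nat" and t :: real
  assumes t: "0 \<le> t" "t \<le> 1"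
begin

lemma greedy_rem_range: "0 \<le> greedy_rem \<sigma> t k \<and> greedy_rem \<sigma> t k \<le> 1"
  by (induction k) (use t greedy_step_range(3,4) in auto)

lemma greedy_rem_less_1:
  assumes "t < 1"
  shows "greedy_rem \<sigma> t k < 1"
  by (induction k) (use assms greedy_rem_range greedy_step_range(5) in auto)

lemma greedy_digit_less: "greedy_digit \<sigma> t (Suc k) < base (\<sigma> (Suc k))"
  using greedy_step_range(1,2)[of "greedy_rem \<sigma> t k" "base (\<sigma> (Suc k))"] greedy_rem_range[of k]
  by (simp add: greedy_digit_def nat_less_iff)

lemma greedy_rem_Suc:
  "greedy_rem \<sigma> t (Suc k) =
     real (base (\<sigma> (Suc k))) * greedy_rem \<sigma> t k - real (greedy_digit \<sigma> t (Suc k))"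
  using greedy_step_range(1)[of "greedy_rem \<sigma> t k" "base (\<sigma> (Suc k))"] greedy_rem_range[of k]
  by (simp add: greedy_digit_def)

text \<open>This turns the real inequality of admissibility into a comparison with the chosen digit;
  the cap does no harm because \<open>c\<close> is itself below the base.\<close>

lemma greedy_digit_iff:
  assumes "c < base (\<sigma> (Suc k))"
  shows "real c \<le> real (base (\<sigma> (Suc k))) * greedy_rem \<sigma> t k \<longleftrightarrow> c \<le> greedy_digit \<sigma> t (Suc k)"
proof -
  have "real c \<le> real (base (\<sigma> (Suc k))) * greedy_rem \<sigma> t k \<longleftrightarrow>
    int c \<le> \<lfloor>real (base (\<sigma> (Suc k))) * greedy_rem \<sigma> t k\<rfloor>"
    by (simp add: le_floor_iff)
  also have "\<dots> \<longleftrightarrow> c \<le> greedy_digit \<sigma> t (Suc k)"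
    using assms greedy_step_range(1)[of "greedy_rem \<sigma> t k" "base (\<sigma> (Suc k))"] greedy_rem_range[of k]
    by (auto simp: greedy_digit_def nat_le_eq_zle le_nat_iff)
  finally show ?thesis .
qed

text \<open>The sum telescopes: by \<open>greedy_rem_Suc\<close> each term is the difference of two
  consecutive values of \<open>greedy_rem \<sigma> t k / mesh \<sigma> k\<close>.\<close>

lemma greedy_partial_sum:
  "(\<Sum>l=1..k. real (greedy_digit \<sigma> t l) / real (mesh \<sigma> l)) = t - greedy_rem \<sigma> t k / real (mesh \<sigma> k)"
proof (induction k)
  case (Suc k)
  have "real (base (\<sigma> (Suc k))) \<noteq> 0" "real (mesh \<sigma> k) \<noteq> 0" by simp_all
  then show ?case
    unfolding greedy_rem_Suc by (simp add: Suc.IH[unfolded One_nat_def] diff_divide_distrib del: greedy_rem.simps)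
qed simp

lemma greedy_sums:
  "(\<lambda>i. real (greedy_digit \<sigma> t (Suc i)) / real (mesh \<sigma> (Suc i))) sums t"
proof -
  have "(\<lambda>k. greedy_rem \<sigma> t k / real (mesh \<sigma> k)) \<longlonglongrightarrow> 0"
  proof (rule Lim_null_comparison)
    show "eventually (\<lambda>k. norm (greedy_rem \<sigma> t k / real (mesh \<sigma> k)) \<le> 1 / real (mesh \<sigma> k)) sequentially"
      using greedy_rem_range by (intro always_eventually) (simp add: divide_right_mono)
    show "(\<lambda>k. 1 / real (mesh \<sigma> k)) \<longlonglongrightarrow> 0"
      using filterlim_inverse_mesh[of \<sigma>] by (simp add: filterlim_at)
  qed
  then have "(\<lambda>k. t - greedy_rem \<sigma> t k / real (mesh \<sigma> k)) \<longlonglongrightarrow> t - 0"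
    by (intro tendsto_diff tendsto_const)
  then have "(\<lambda>k. \<Sum>l=1..k. real (greedy_digit \<sigma> t l) / real (mesh \<sigma> l)) \<longlonglongrightarrow> t"
    unfolding greedy_partial_sum by simp
  moreover have "(\<Sum>l=1..k. real (greedy_digit \<sigma> t l) / real (mesh \<sigma> l)) =
      (\<Sum>i<k. real (greedy_digit \<sigma> t (Suc i)) / real (mesh \<sigma> (Suc i)))" for k
    by (simp only: One_nat_def sum.atLeast1_atMost_eq)
  ultimately show ?thesis by (simp only: sums_def)
qed

lemma greedy_expansion_greedy_digit:
  assumes \<sigma>: "\<And>i. i \<ge> 1 \<Longrightarrow> \<sigma> i \<in> {0, 1}"
    and N: "N \<ge> 1"
    and a: "a = strip_left M N \<kappa> + t / real N"
  shows "greedy_expansion M N \<kappa> \<sigma> a (greedy_digit \<sigma> t)"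
proof -
  let ?\<xi> = "greedy_digit \<sigma> t"
  have digit_term_eq: "digit_term \<sigma> \<xi> i = real (\<xi> i) / real (mesh \<sigma> i)" for \<xi> i
    by (simp add: digit_term_def mesh_eq[OF \<sigma>])
  have adm: "admissible_digits M N \<kappa> \<sigma> a ?\<xi> (Suc k) = {c. c < base (\<sigma> (Suc k)) \<and> c \<le> ?\<xi> (Suc k)}" for k
  proof -
    have "strip_left M N \<kappa> + 1 / real N * (\<Sum>l=1..Suc k. digit_term \<sigma> (?\<xi>(Suc k := c)) l) \<le> a \<longleftrightarrow>
        real c \<le> real (base (\<sigma> (Suc k))) * greedy_rem \<sigma> t k" for c
    proof -
      \<comment> \<open>Replacing the digit at place \<open>Suc k\<close> affects only the last
        summand; the rest is the greedy partial sum.\<close>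
      have "(\<Sum>l=1..Suc k. digit_term \<sigma> (?\<xi>(Suc k := c)) l) =
          (\<Sum>l=1..k. digit_term \<sigma> (?\<xi>(Suc k := c)) l) + real c / real (mesh \<sigma> (Suc k))"
        by (simp add: digit_term_eq del: mesh.simps)
      also have "(\<Sum>l=1..k. digit_term \<sigma> (?\<xi>(Suc k := c)) l) = t - greedy_rem \<sigma> t k / real (mesh \<sigma> k)"
        unfolding greedy_partial_sum[symmetric] by (rule sum.cong) (simp_all add: digit_term_eq)
      finally have sum: "(\<Sum>l=1..Suc k. digit_term \<sigma> (?\<xi>(Suc k := c)) l) =
          t - greedy_rem \<sigma> t k / real (mesh \<sigma> k) + real c / real (mesh \<sigma> (Suc k))" .
      have "strip_left M N \<kappa> + 1 / real N * (\<Sum>l=1..Suc k. digit_term \<sigma> (?\<xi>(Suc k := c)) l) \<le> a \<longleftrightarrow>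
          real c / real (mesh \<sigma> (Suc k)) \<le> greedy_rem \<sigma> t k / real (mesh \<sigma> k)"
        unfolding sum a using N by (simp add: field_simps)
      also have "\<dots> \<longleftrightarrow> real c \<le> real (base (\<sigma> (Suc k))) * greedy_rem \<sigma> t k"
        by (simp add: divide_simps mult_ac)
      finally show ?thesis .
    qed
    then show ?thesis unfolding admissible_digits_def using greedy_digit_iff by blast
  qed
  show ?thesis
    unfolding greedy_expansion_def
  proof (intro allI impI)
    fix i :: nat assume "i \<ge> 1"
    then obtain k where "i = Suc k" by (cases i) auto
    then show "?\<xi> i \<in> admissible_digits M N \<kappa> \<sigma> a ?\<xi> i \<and>
        (\<forall>c\<in>admissible_digits M N \<kappa> \<sigma> a ?\<xi> i. c \<le> ?\<xi> i)"
      using greedy_digit_less by (simp add: adm)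
  qed
qed

end

section \<open>Choice of the strip and conclusion\<close>

primrec integer_part :: "(nat \<Rightarrow> nat) \<Rightarrow> (nat \<Rightarrow> nat) \<Rightarrow> int \<Rightarrow> nat \<Rightarrow> int" where
  "integer_part \<sigma> \<xi> m 0 = m"
| "integer_part \<sigma> \<xi> m (Suc k) = int (base (\<sigma> (Suc k))) * integer_part \<sigma> \<xi> m k + int (\<xi> (Suc k))"

theorem theorem2:
  fixes \<theta> a :: real and M N :: nat and \<sigma> :: "nat \<Rightarrow> nat"
  assumes "0 \<le> \<theta>" and "\<theta> < pi / 2"
    and "N \<ge> 1"
    and "tan \<theta> = real M / real N"
    and "\<And>i. i \<ge> 1 \<Longrightarrow> \<sigma> i \<in> {0, 1}"
    and "a \<in> {- (real M / real N)..1}"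
  shows "\<exists>\<kappa>\<in>{1..N + M}. a \<in> strip M N \<kappa> \<and>
    (\<exists>\<xi>. greedy_expansion M N \<kappa> \<sigma> a \<xi> \<and>
      summable (\<lambda>i. digit_term \<sigma> \<xi> (Suc i)) \<and>
      a = strip_left M N \<kappa> + 1 / real N * (\<Sum>i. digit_term \<sigma> \<xi> (Suc i)) \<and>
      upper_box_dim (carpet \<sigma> \<inter> line \<theta> a) =
        limsup (\<lambda>k. ereal (growth_quotient M N \<kappa> \<sigma> \<xi> k)) \<and>
      lower_box_dim (carpet \<sigma> \<inter> line \<theta> a) =
        liminf (\<lambda>k. ereal (growth_quotient M N \<kappa> \<sigma> \<xi> k)))"
proof -
  \<comment> \<open>\<open>N * a\<close> is split into an integer \<open>m\<close> and a rest
    \<open>t\<close>. The cap \<open>N - 1\<close> sends \<open>a = 1\<close> to the closed last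
    strip, with \<open>t = 1\<close>.\<close>
  define m where "m = min \<lfloor>real N * a\<rfloor> (int N - 1)"
  define \<kappa> where "\<kappa> = nat (m + int M + 1)"
  define t where "t = real N * a - of_int m"
  define \<xi> where "\<xi> = greedy_digit \<sigma> t"
  \<comment> \<open>Horner evaluation of \<open>m\<close> followed by the greedy digits; together
    with the greedy remainder it makes up \<open>N * mesh \<sigma> k * a\<close>.\<close>
  define D where "D = integer_part \<sigma> \<xi> m"
  have N: "0 < real N" using assms(3) by simp
  have Na: "- real M \<le> real N * a" "real N * a \<le> real N"
    using assms(6) N by (auto simp: field_simps)
  have m: "- int M \<le> m" "m \<le> int N - 1" using Na assms(3) by (auto simp: m_def le_floor_iff)
  then have \<kappa>: "\<kappa> \<in> {1..N + M}" and m_eq: "m = int \<kappa> - int M - 1" by (auto simp: \<kappa>_def)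
  have m_cases: "m = \<lfloor>real N * a\<rfloor> \<or> m = int N - 1" and "m \<le> \<lfloor>real N * a\<rfloor>" by (auto simp: m_def)
  then have t: "0 \<le> t" "t \<le> 1" unfolding t_def using Na by linarith+
  have t_less: "t < 1" if "a < 1"
  proof -
    have "real N * a < real N * 1" using that N by (intro mult_strict_left_mono) auto
    then show ?thesis using m_cases unfolding t_def by linarith
  qed
  have left: "strip_left M N \<kappa> = of_int m / real N" and right: "strip_right M N \<kappa> = (of_int m + 1) / real N"
    by (simp_all add: strip_left_def strip_right_def m_eq)
  have a_eq: "a = strip_left M N \<kappa> + t / real N"
    using N by (simp add: left t_def field_simps)
  have strip: "a \<in> strip M N \<kappa>"
  proof -
    have "strip_left M N \<kappa> \<le> a" using a_eq t N by simp
    moreover have "a \<le> strip_right M N \<kappa>"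
      using t N by (simp add: right t_def field_simps)
    moreover have "a < strip_right M N \<kappa>" if "\<kappa> \<noteq> N + M"
    proof -
      \<comment> \<open>Outside the last strip \<open>m\<close> is a genuine floor, hence
        \<open>t < 1\<close> and the strip may be half-open.\<close>
      have "m \<noteq> int N - 1" using that by (auto simp: \<kappa>_def nat_eq_iff)
      then have "t < 1" using m_cases unfolding t_def by linarith
      then show ?thesis using N by (simp add: right t_def field_simps)
    qed
    ultimately show ?thesis by (auto simp: strip_def)
  qed
  interpret carpet_slice M N \<sigma> \<xi> a \<kappa> D "greedy_rem \<sigma> t"
  proof
    show "real N * real (mesh \<sigma> k) * a = of_int (D k) + greedy_rem \<sigma> t k" for k
    proof (induction k)
      case 0
      then show ?case by (simp add: D_def t_def)
    next
      case (Suc k)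
      have "real N * real (mesh \<sigma> (Suc k)) * a =
          real (base (\<sigma> (Suc k))) * (real N * real (mesh \<sigma> k) * a)" by simp
      also have "\<dots> = of_int (D (Suc k)) + greedy_rem \<sigma> t (Suc k)"
        unfolding Suc greedy_rem_Suc[OF t] by (simp add: D_def \<xi>_def distrib_left)
      finally show ?case .
    qed
    show "a \<le> 1" using assms(6) by simp
  qed (use assms(3) \<kappa> t m_eq greedy_digit_less[OF t] greedy_rem_range[OF t] greedy_rem_less_1[OF t] t_less
      in \<open>auto simp: D_def \<xi>_def\<close>)
  have slice: "carpet \<sigma> \<inter> line \<theta> a = slice"
    by (simp add: slice_def line_def assms(4))
  have "growth_quotient M N \<kappa> \<sigma> \<xi> k = level_ratio k" for k
  proof -
    have "ln (real (mesh \<sigma> k)) = real (n0 \<sigma> k) * ln 3 + real (n1 \<sigma> k) * ln 4"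
      by (simp add: mesh_eq[OF assms(5)] ln_mult_pos ln_realpow)
    then show ?thesis by (simp add: growth_quotient_def level_ratio_def sum_mat_row_prod)
  qed
  then have dims: "upper_box_dim (carpet \<sigma> \<inter> line \<theta> a) = limsup (\<lambda>k. ereal (growth_quotient M N \<kappa> \<sigma> \<xi> k))"
    "lower_box_dim (carpet \<sigma> \<inter> line \<theta> a) = liminf (\<lambda>k. ereal (growth_quotient M N \<kappa> \<sigma> \<xi> k))"
    by (simp_all add: slice box_dim_slice)
  have "digit_term \<sigma> \<xi> (Suc i) = real (\<xi> (Suc i)) / real (mesh \<sigma> (Suc i))" for i
    by (simp only: digit_term_def mesh_eq[OF assms(5)]) simp
  then have sums: "(\<lambda>i. digit_term \<sigma> \<xi> (Suc i)) sums t"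
    using greedy_sums[OF t, of \<sigma>] by (simp only: \<xi>_def)
  have "greedy_expansion M N \<kappa> \<sigma> a \<xi>"
    unfolding \<xi>_def by (rule greedy_expansion_greedy_digit[OF t assms(5,3) a_eq])
  moreover have "a = strip_left M N \<kappa> + 1 / real N * (\<Sum>i. digit_term \<sigma> \<xi> (Suc i))"
    using a_eq by (simp add: sums_unique[OF sums, symmetric])
  ultimately show ?thesis using \<kappa> strip dims sums_summable[OF sums] by blast
qed

end
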